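(* Assume that $n \alpha_n \to 0$ and $n \alpha_n / \beta_n \to \lambda \in [0, \infty]$ as $n\to\infty$. Then $$\left( \sigma_n \widetilde M_n \right)^{n \alpha_n}$$ converges in distribution to $U_\lambda$ as $n\to\infty$, where $U_\lambda$ is the distribution of $B_{\lambda} U + (1-B_{\lambda})$, the random variables $U$ and $B_{\lambda}$ are independent, $P(B_{\lambda}=1)=\frac1{1+\lambda}=1-P(B_{\lambda}=0)$, $U$ is uniform on $(0, 1)$, and $$\sigma_n = \begin{cases} \beta_n, &\text{when } \beta_n \to \infty,\\ 1, &\text{otherwise.} \end{cases}$$ When $\lambda=\infty$, $B_\infty$ is interpreted as the random variable degenerate at $0$.
   Context: Let $(\alpha_n)_{n\ge1}$ and $(\beta_n)_{n\ge1}$ be sequences of positive real numbers. For each $n$, let $\boldsymbol{X}_n=(X_{1n},\ldots,X_{nn})$ have the $n$-dimensional Dirichlet distribution with parameters $\alpha_n,\ldots,\alpha_n,\beta_n$ ($\alpha_n$ repeated $n$ times), i.e. with density $$\frac{\Gamma(n\alpha_n+\beta_n)}{\Gamma(\alpha_n)^n\,\Gamma(\beta_n)}\Bigl(\prod_{i=1}^n x_i\Bigr)^{\alpha_n-1}\Bigl(1-\sum_{i=1}^n x_i\Bigr)^{\beta_n-1}$$ on $\{\boldsymbol x: x_i\ge 0,\ 0\le\sum_{i=1}^n x_i\le 1\}$. Let $\widetilde M_n=\max\{X_{1n},\ldots,X_{nn}\}$.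
   Formalization: When β_n does not tend to ∞, the formal theorem also assumes nα_n·log max(1,β_n) → 0 (automatic if β_n is bounded or λ>0). Without it the claim fails: nα_n = 1/log n, β_n = n for even n and 1 for odd n gives limits U/e and U along the two subsequences. *)

theory Defs
  imports "HOL-Probability.Probability"
begin

text \<open>Density of the Dirichlet law with parameters \<open>a, \<dots>, a\<close> (\<open>n\<close> times) and \<open>b\<close>, with respect
  to Lebesgue measure on \<open>\<real>\<^sup>n\<close>, realised as the product \<open>Pi\<^sub>M {1..n} (\<lambda>_. lborel)\<close>. The convention
  \<open>0 powr c = 0\<close> only affects the boundary of the simplex, which is a null set.\<close>

definition dirichlet_density :: "nat \<Rightarrow> real \<Rightarrow> real \<Rightarrow> (nat \<Rightarrow> real) \<Rightarrow> real" where
  "dirichlet_density n a b x =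
     (if (\<forall>i\<in>{1..n}. 0 \<le> x i) \<and> (\<Sum>i=1..n. x i) \<le> 1
      then Gamma (real n * a + b) / (Gamma a ^ n * Gamma b)
           * (\<Prod>i=1..n. x i) powr (a - 1) * (1 - (\<Sum>i=1..n. x i)) powr (b - 1)
      else 0)"

text \<open>The case distinction concerns the whole sequence \<open>\<beta>\<close>, not the single value \<open>\<beta> n\<close>. If
  \<open>\<beta>\<close> is unbounded without tending to infinity, normalising by \<open>1\<close> can fail to give convergence:
  take \<open>n * \<alpha> n = 1 / ln n\<close>, \<open>\<beta> n = n\<close> for even \<open>n\<close> and \<open>\<beta> n = 1\<close> for odd \<open>n\<close>. Then
  \<open>\<beta> n powr (n * \<alpha> n)\<close> does not tend to \<open>1\<close>, and the two subsequences have different limit laws.\<close>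

definition scale_seq :: "(nat \<Rightarrow> real) \<Rightarrow> nat \<Rightarrow> real" where
  "scale_seq \<beta> n = (if filterlim \<beta> at_top sequentially then \<beta> n else 1)"

text \<open>The law of \<open>B * U + (1 - B)\<close>; the product measure makes \<open>B\<close> and \<open>U\<close> independent, and the
  values \<open>True\<close>, \<open>False\<close> of the Bernoulli variable stand for \<open>1\<close>, \<open>0\<close>. For \<open>l = \<infinity>\<close> the success
  probability is \<open>1 / \<infinity> = 0\<close>, so \<open>B\<close> is degenerate at \<open>0\<close>.\<close>

definition U_law :: "ennreal \<Rightarrow> real measure" where
  "U_law l =
     distr (measure_pmf (bernoulli_pmf (enn2real (1 / (1 + l))))
              \<Otimes>\<^sub>M uniform_measure lborel {0<..<1::real})
           borel (\<lambda>(B, U). of_bool B * U + (1 - of_bool B))"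

end

theory Submission
  imports Defs
begin

text \<open>
  Put \<open>c = n * \<alpha> n\<close> and \<open>S = X\<^sub>1 + \<dots> + X\<^sub>n\<close>. Liouville's integral formula shows that \<open>S\<close> has the
  Beta law with parameters \<open>c\<close> and \<open>\<beta> n\<close>, and that the mean of \<open>(\<Sum>X\<^sub>i\<^sup>2) / S\<^sup>2\<close> is
  \<open>(\<alpha> n + 1) / (c + 1)\<close>. As \<open>c\<close> tends to \<open>0\<close>, a single coordinate carries almost all of \<open>S\<close>: the
  maximum lies between \<open>S / 2\<close> and \<open>S\<close> outside an event of probability at most \<open>2 * c\<close>, and the
  factor \<open>2\<close> disappears on taking the power \<open>c\<close>. It remains to find the limit law of
  \<open>(\<sigma> * S) powr c\<close>. At the relevant points \<open>y = k * x powr (1 / c) / \<sigma>\<close> the Beta distribution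
  function is asymptotic to \<open>y powr c / (c * Beta c (\<beta> n))\<close>, and log-convexity of \<open>Gamma\<close> shows
  that this tends to \<open>x / (1 + l)\<close>.
\<close>

section \<open>The Liouville integral\<close>

text \<open>The cut-off at 0 puts the constraints of the simplex into the integrand, so all
  integrals run over the full space; values in \<open>ennreal\<close> let Tonelli apply without
  integrability checks.\<close>

definition power_kernel :: "real \<Rightarrow> real \<Rightarrow> ennreal" where
  "power_kernel a x = ennreal (if 0 < x then x powr (a - 1) else 0)"

lemma measurable_power_kernel [measurable]: "power_kernel a \<in> borel_measurable borel"
  unfolding power_kernel_def by measurable

lemma power_kernel_nonpos: "x \<le> 0 \<Longrightarrow> power_kernel a x = 0"
  by (simp add: power_kernel_def)

lemma power_kernel_scale:
  assumes "0 < t"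
  shows "power_kernel a (t * x) = ennreal (t powr (a - 1)) * power_kernel a x"
  using assms by (auto simp: power_kernel_def powr_mult zero_less_mult_iff simp flip: ennreal_mult')

lemma nn_integral_power_kernel_Beta:
  assumes "0 < a" "0 < b"
  shows "(\<integral>\<^sup>+x. power_kernel a x * power_kernel b (1 - x) \<partial>lborel) = ennreal (Beta a b)"
proof -
  have "(\<integral>\<^sup>+x. ennreal (indicator {0..1} x * (x powr (a - 1) * (1 - x) powr (b - 1))) \<partial>lborel) = ennreal (Beta a b)"
    using has_integral_Beta_real[OF assms] by (intro nn_integral_has_integral_lebesgue) auto
  moreover have "power_kernel a x * power_kernel b (1 - x) =
      ennreal (indicator {0..1} x * (x powr (a - 1) * (1 - x) powr (b - 1)))" for x :: real
    by (auto simp: power_kernel_def indicator_def simp flip: ennreal_mult')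
  ultimately show ?thesis by simp
qed

text \<open>For \<open>t > 0\<close> the substitution \<open>x = t * u\<close> reduces to the Beta
  integral; the Jacobian and the two kernels contribute \<open>t\<close> to the power
  \<open>1 + (a - 1) + (b - 1)\<close>. For \<open>t \<le> 0\<close> the numbers \<open>x\<close>
  and \<open>t - x\<close> are never both positive.\<close>

lemma power_kernel_convolution:
  assumes "0 < a" "0 < b"
  shows "(\<integral>\<^sup>+x. power_kernel a x * power_kernel b (t - x) \<partial>lborel) = ennreal (Beta a b) * power_kernel (a + b) t"
proof (cases "0 < t")
  case True
  have "(\<integral>\<^sup>+x. power_kernel a x * power_kernel b (t - x) \<partial>lborel) =
      ennreal t * (\<integral>\<^sup>+x. power_kernel a (t * x) * power_kernel b (t * (1 - x)) \<partial>lborel)"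
    using True by (subst nn_integral_real_affine[where t = 0 and c = t]) (auto simp: algebra_simps)
  also have "\<dots> = ennreal t * (\<integral>\<^sup>+x. (ennreal (t powr (a - 1)) * ennreal (t powr (b - 1))) *
      (power_kernel a x * power_kernel b (1 - x)) \<partial>lborel)"
    unfolding power_kernel_scale[OF True] by (simp only: mult_ac)
  also have "\<dots> = ennreal t * (ennreal (t powr (a - 1)) * ennreal (t powr (b - 1)) * ennreal (Beta a b))"
    by (subst nn_integral_cmult) (auto simp: nn_integral_power_kernel_Beta assms)
  also have "\<dots> = ennreal (Beta a b) * (ennreal t * ennreal (t powr (a - 1)) * ennreal (t powr (b - 1)))"
    by (simp add: mult_ac)
  also have "ennreal t * ennreal (t powr (a - 1)) * ennreal (t powr (b - 1)) = power_kernel (a + b) t"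
  proof -
    have "t * t powr (a - 1) * t powr (b - 1) = t powr (1 + (a - 1) + (b - 1))"
      using True by (simp only: powr_add) simp
    then show ?thesis
      using True by (simp add: power_kernel_def algebra_simps flip: ennreal_mult')
  qed
  finally show ?thesis .
next
  case False
  then have "power_kernel a x * power_kernel b (t - x) = 0" for x
    by (auto simp: power_kernel_def)
  then have "(\<integral>\<^sup>+x. power_kernel a x * power_kernel b (t - x) \<partial>lborel) = (\<integral>\<^sup>+x. 0 \<partial>(lborel :: real measure))"
    by (intro nn_integral_cong) blast
  with False show ?thesis by (simp add: power_kernel_nonpos)
qed

lemma Beta_pos: "0 < a \<Longrightarrow> 0 < b \<Longrightarrow> 0 < Beta a (b::real)"
  by (simp add: Beta_def Gamma_real_pos)

text \<open>Two variables merge into one by adding exponents: after the translation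
  \<open>t = s + y\<close>, Tonelli leaves a convolution of kernels. This drives the induction for
  the Liouville formula.\<close>

lemma nn_integral_power_kernel_sum:
  assumes "0 < a" "0 < b" and [measurable]: "f \<in> borel_measurable borel"
  shows "(\<integral>\<^sup>+y. power_kernel a y * (\<integral>\<^sup>+s. power_kernel b s * f (s + y) \<partial>lborel) \<partial>lborel) =
    ennreal (Beta a b) * (\<integral>\<^sup>+t. power_kernel (a + b) t * f t \<partial>lborel)"
proof -
  have "(\<integral>\<^sup>+y. power_kernel a y * (\<integral>\<^sup>+s. power_kernel b s * f (s + y) \<partial>lborel) \<partial>lborel) =
    (\<integral>\<^sup>+y. power_kernel a y * (\<integral>\<^sup>+t. power_kernel b (t - y) * f t \<partial>lborel) \<partial>lborel)"
  proof (rule nn_integral_cong)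
    fix y :: real
    have "(\<integral>\<^sup>+t. power_kernel b (t - y) * f t \<partial>lborel) = (\<integral>\<^sup>+s. power_kernel b s * f (s + y) \<partial>lborel)"
      by (subst nn_integral_real_affine[where t = y and c = 1]) (auto simp: algebra_simps)
    then show "power_kernel a y * (\<integral>\<^sup>+s. power_kernel b s * f (s + y) \<partial>lborel) =
      power_kernel a y * (\<integral>\<^sup>+t. power_kernel b (t - y) * f t \<partial>lborel)" by simp
  qed
  also have "\<dots> = (\<integral>\<^sup>+y. \<integral>\<^sup>+t. power_kernel a y * (power_kernel b (t - y) * f t) \<partial>lborel \<partial>lborel)"
    by (simp add: nn_integral_cmult)
  also have "\<dots> = (\<integral>\<^sup>+t. \<integral>\<^sup>+y. power_kernel a y * (power_kernel b (t - y) * f t) \<partial>lborel \<partial>lborel)"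
    by (rule lborel_pair.Fubini') measurable
  also have "\<dots> = (\<integral>\<^sup>+t. (\<integral>\<^sup>+y. power_kernel a y * power_kernel b (t - y) \<partial>lborel) * f t \<partial>lborel)"
    by (simp add: nn_integral_multc flip: mult.assoc)
  also have "\<dots> = (\<integral>\<^sup>+t. ennreal (Beta a b) * (power_kernel (a + b) t * f t) \<partial>lborel)"
    by (simp add: power_kernel_convolution assms mult_ac)
  also have "\<dots> = ennreal (Beta a b) * (\<integral>\<^sup>+t. power_kernel (a + b) t * f t \<partial>lborel)"
    by (simp add: nn_integral_cmult)
  finally show ?thesis .
qed

text \<open>Coordinates are merged one at a time. Each merge costs a Beta factor, and the Gamma
  values of the partial sums telescope, leaving only that of the total.\<close>

lemma Liouville_integral:
  assumes "finite I" "I \<noteq> {}" "\<And>i. i \<in> I \<Longrightarrow> 0 < a i" "f \<in> borel_measurable borel"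
  shows "(\<integral>\<^sup>+x. (\<Prod>i\<in>I. power_kernel (a i) (x i)) * f (\<Sum>i\<in>I. x i) \<partial>Pi\<^sub>M I (\<lambda>_. lborel)) =
    ennreal ((\<Prod>i\<in>I. Gamma (a i)) / Gamma (\<Sum>i\<in>I. a i)) *
      (\<integral>\<^sup>+s. power_kernel (\<Sum>i\<in>I. a i) s * f s \<partial>lborel)"
  using assms
proof (induction I arbitrary: f rule: finite_ne_induct)
  case (singleton i)
  interpret product_sigma_finite "\<lambda>_. lborel :: real measure" ..
  have [measurable]: "f \<in> borel_measurable borel" by fact
  have "Gamma (a i) > 0" using singleton by (simp add: Gamma_real_pos)
  then show ?case
    using product_nn_integral_singleton[of "\<lambda>x. power_kernel (a i) x * f x" i] by simp
next
  case (insert j I)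
  interpret product_sigma_finite "\<lambda>_. lborel :: real measure" ..
  have [measurable]: "f \<in> borel_measurable borel" by fact
  let ?A = "\<Sum>i\<in>I. a i"
  have A: "0 < ?A" using insert by (intro sum_pos) auto
  have aj: "0 < a j" using insert by simp
  have *: "(\<Prod>i\<in>insert j I. power_kernel (a i) ((x(j := y)) i)) = power_kernel (a j) y * (\<Prod>i\<in>I. power_kernel (a i) (x i))"
     "(\<Sum>i\<in>insert j I. (x(j := y)) i) = (\<Sum>i\<in>I. x i) + y" for x y
  proof -
    have "(\<Prod>i\<in>I. power_kernel (a i) ((x(j := y)) i)) = (\<Prod>i\<in>I. power_kernel (a i) (x i))"
      using insert by (intro prod.cong) auto
    then show "(\<Prod>i\<in>insert j I. power_kernel (a i) ((x(j := y)) i)) = power_kernel (a j) y * (\<Prod>i\<in>I. power_kernel (a i) (x i))"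
      using insert by simp
    have "(\<Sum>i\<in>I. (x(j := y)) i) = (\<Sum>i\<in>I. x i)"
      using insert by (intro sum.cong) auto
    then show "(\<Sum>i\<in>insert j I. (x(j := y)) i) = (\<Sum>i\<in>I. x i) + y"
      using insert by simp
  qed
  have "(\<integral>\<^sup>+x. (\<Prod>i\<in>insert j I. power_kernel (a i) (x i)) * f (\<Sum>i\<in>insert j I. x i) \<partial>Pi\<^sub>M (insert j I) (\<lambda>_. lborel)) =
    (\<integral>\<^sup>+y. \<integral>\<^sup>+x. (\<Prod>i\<in>insert j I. power_kernel (a i) ((x(j := y)) i)) * f (\<Sum>i\<in>insert j I. (x(j := y)) i) \<partial>Pi\<^sub>M I (\<lambda>_. lborel) \<partial>lborel)"
    using insert by (intro product_nn_integral_insert_rev) auto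
  also have "\<dots> = (\<integral>\<^sup>+y. power_kernel (a j) y * (\<integral>\<^sup>+x. (\<Prod>i\<in>I. power_kernel (a i) (x i)) * f ((\<Sum>i\<in>I. x i) + y) \<partial>Pi\<^sub>M I (\<lambda>_. lborel)) \<partial>lborel)"
    unfolding * mult.assoc by (intro nn_integral_cong nn_integral_cmult) measurable
  \<comment> \<open>The induction hypothesis is applied to the translate of \<open>f\<close> by
    \<open>y\<close>, which is why \<open>f\<close> is arbitrary in the induction.\<close>
  also have "\<dots> = (\<integral>\<^sup>+y. power_kernel (a j) y * (ennreal ((\<Prod>i\<in>I. Gamma (a i)) / Gamma ?A) *
      (\<integral>\<^sup>+s. power_kernel ?A s * f (s + y) \<partial>lborel)) \<partial>lborel)"
    using insert by (subst insert.IH) auto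
  also have "\<dots> = ennreal ((\<Prod>i\<in>I. Gamma (a i)) / Gamma ?A) *
     (\<integral>\<^sup>+y. power_kernel (a j) y * (\<integral>\<^sup>+s. power_kernel ?A s * f (s + y) \<partial>lborel) \<partial>lborel)"
    by (subst nn_integral_cmult[symmetric]) (auto simp: mult_ac)
  also have "\<dots> = ennreal ((\<Prod>i\<in>I. Gamma (a i)) / Gamma ?A) * ennreal (Beta (a j) ?A) *
     (\<integral>\<^sup>+t. power_kernel (a j + ?A) t * f t \<partial>lborel)"
    using A aj by (subst nn_integral_power_kernel_sum) (auto simp: mult_ac)
  also have "ennreal ((\<Prod>i\<in>I. Gamma (a i)) / Gamma ?A) * ennreal (Beta (a j) ?A) =
     ennreal ((\<Prod>i\<in>insert j I. Gamma (a i)) / Gamma (a j + ?A))"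
  proof -
    have "Gamma ?A > 0" "0 \<le> (\<Prod>i\<in>I. Gamma (a i))" using A insert
      by (auto intro!: prod_nonneg simp: Gamma_real_pos less_imp_le)
    moreover have "Gamma ?A \<noteq> 0" using \<open>Gamma ?A > 0\<close> by simp
    ultimately show ?thesis using Beta_pos[OF aj A] insert.hyps
      by (simp add: Beta_def field_simps flip: ennreal_mult')
  qed
  finally show ?case using insert by simp
qed

section \<open>The sum and the maximum under a Dirichlet law\<close>

lemma Gamma_real_plus1: "0 < z \<Longrightarrow> Gamma (z + 1) = z * Gamma (z::real)"
  by (intro Gamma_plus1) (auto elim!: nonpos_Ints_cases')

lemma Gamma_real_plus2: "0 < z \<Longrightarrow> Gamma (z + 2) = (z + 1) * (z * Gamma (z::real))"
  using Gamma_real_plus1[of z] Gamma_real_plus1[of "z + 1"] by (simp add: add.assoc)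

text \<open>A squared coordinate is absorbed by raising its parameter, which turns second moments
  into Liouville integrals.\<close>

lemma power_kernel_add2: "power_kernel (a + 2) x = ennreal (x\<^sup>2) * power_kernel a x"
proof (cases "0 < x")
  case True
  have "x powr (a + 2 - 1) = x powr 2 * x powr (a - 1)"
    by (simp add: powr_add[symmetric])
  with True show ?thesis by (simp add: power_kernel_def flip: ennreal_mult')
qed (simp add: power_kernel_def)

text \<open>The equality is pointwise, boundary included: a vanishing coordinate or a coordinate sum
  equal to 1 makes both sides zero because \<open>0 powr c = 0\<close>.\<close>

lemma dirichlet_density_eq_power_kernel:
  assumes "0 < a" "0 < b"
  shows "ennreal (dirichlet_density n a b x) =
    ennreal (Gamma (real n * a + b) / (Gamma a ^ n * Gamma b)) *
      ((\<Prod>i=1..n. power_kernel a (x i)) * power_kernel b (1 - (\<Sum>i=1..n. x i)))"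
proof -
  have K: "0 \<le> Gamma (real n * a + b) / (Gamma a ^ n * Gamma b)"
    using assms by (intro divide_nonneg_nonneg mult_nonneg_nonneg zero_le_power Gamma_real_nonneg)
      (auto intro: add_nonneg_pos)
  show ?thesis
  proof (cases "\<forall>i\<in>{1..n}. 0 < x i")
    case True
    then have "(\<Prod>i=1..n. power_kernel a (x i)) = ennreal ((\<Prod>i=1..n. x i) powr (a - 1))"
      unfolding prod_powr_distrib by (subst prod_ennreal[symmetric]) (auto intro!: prod.cong simp: power_kernel_def)
    moreover have "power_kernel b (1 - (\<Sum>i=1..n. x i)) =
      ennreal (if (\<Sum>i=1..n. x i) \<le> 1 then (1 - (\<Sum>i=1..n. x i)) powr (b - 1) else 0)"
      by (auto simp: power_kernel_def not_less)
    moreover have "\<forall>i\<in>{1..n}. 0 \<le> x i" using True by (blast intro: less_imp_le)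
    ultimately show ?thesis using K by (auto simp: dirichlet_density_def simp flip: ennreal_mult' mult.assoc)
  next
    case False
    then obtain i where i: "i \<in> {1..n}" "x i \<le> 0" by auto
    then have "(\<Prod>i=1..n. power_kernel a (x i)) = 0"
      by (auto simp: power_kernel_nonpos intro!: prod_zero bexI[of _ i])
    moreover have "dirichlet_density n a b x = 0"
    proof (cases "x i = 0")
      case True
      then have "(\<Prod>i=1..n. x i) = 0" using i by (intro prod_zero) auto
      then show ?thesis by (simp add: dirichlet_density_def)
    qed (use i in \<open>force simp: dirichlet_density_def\<close>)
    ultimately show ?thesis by simp
  qed
qed

lemma measurable_dirichlet_density [measurable]:
  "dirichlet_density n a b \<in> borel_measurable (Pi\<^sub>M {1..n} (\<lambda>_. lborel))"
  unfolding dirichlet_density_def by measurable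

text \<open>The last kernel depends on \<open>x\<close> only through the coordinate sum, so it joins
  \<open>f\<close> in the Liouville formula, and the Gamma factors collapse to a reciprocal Beta
  value. Hence the sum has the Beta law with parameters \<open>real n * a\<close> and
  \<open>b\<close>.\<close>

lemma nn_integral_dirichlet_sum:
  assumes "1 \<le> n" "0 < a" "0 < b" and [measurable]: "f \<in> borel_measurable borel"
  shows "(\<integral>\<^sup>+x. ennreal (dirichlet_density n a b x) * f (\<Sum>i=1..n. x i) \<partial>Pi\<^sub>M {1..n} (\<lambda>_. lborel)) =
    ennreal (1 / Beta (real n * a) b) *
      (\<integral>\<^sup>+s. power_kernel (real n * a) s * power_kernel b (1 - s) * f s \<partial>lborel)"
proof -
  let ?K = "Gamma (real n * a + b) / (Gamma a ^ n * Gamma b)"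
  have na: "0 < real n * a" using assms by simp
  have "(\<integral>\<^sup>+x. ennreal (dirichlet_density n a b x) * f (\<Sum>i=1..n. x i) \<partial>Pi\<^sub>M {1..n} (\<lambda>_. lborel)) =
     ennreal ?K * (\<integral>\<^sup>+x. (\<Prod>i=1..n. power_kernel a (x i)) *
       (power_kernel b (1 - (\<Sum>i=1..n. x i)) * f (\<Sum>i=1..n. x i)) \<partial>Pi\<^sub>M {1..n} (\<lambda>_. lborel))"
    using assms by (subst nn_integral_cmult[symmetric])
      (auto simp: dirichlet_density_eq_power_kernel mult_ac)
  also have "\<dots> = ennreal ?K * (ennreal ((\<Prod>i=1..n. Gamma a) / Gamma (\<Sum>i=1..n. a)) *
      (\<integral>\<^sup>+s. power_kernel (\<Sum>i=1..n. a) s * (power_kernel b (1 - s) * f s) \<partial>lborel))"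
    using assms
    by (subst Liouville_integral[of "{1..n}" "\<lambda>_. a" "\<lambda>s. power_kernel b (1 - s) * f s"]) auto
  also have "\<dots> = ennreal ?K * ennreal (Gamma a ^ n / Gamma (real n * a)) *
      (\<integral>\<^sup>+s. power_kernel (real n * a) s * power_kernel b (1 - s) * f s \<partial>lborel)"
    by (simp add: mult_ac)
  also have "ennreal ?K * ennreal (Gamma a ^ n / Gamma (real n * a)) = ennreal (1 / Beta (real n * a) b)"
  proof -
    have "Gamma a \<noteq> 0" "Gamma b \<noteq> 0" "Gamma (real n * a) \<noteq> 0" "Gamma (real n * a + b) \<noteq> 0"
      using assms na by (simp_all add: less_imp_neq[symmetric] add_pos_pos)
    then have "?K * (Gamma a ^ n / Gamma (real n * a)) = 1 / Beta (real n * a) b"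
      by (simp add: Beta_def)
    moreover have "0 \<le> Gamma a ^ n / Gamma (real n * a)" using assms na by simp
    ultimately show ?thesis by (metis ennreal_mult'')
  qed
  finally show ?thesis .
qed

lemma nn_integral_dirichlet:
  assumes "1 \<le> n" "0 < a" "0 < b"
  shows "(\<integral>\<^sup>+x. ennreal (dirichlet_density n a b x) \<partial>Pi\<^sub>M {1..n} (\<lambda>_. lborel)) = 1"
proof -
  have na: "0 < real n * a" using assms by simp
  show ?thesis
    using nn_integral_dirichlet_sum[OF assms, of "\<lambda>_. 1"] nn_integral_power_kernel_Beta[OF na assms(3)]
      Beta_pos[OF na assms(3)]
    by (simp flip: ennreal_mult')
qed

text \<open>The squared coordinate raises its own parameter and the total by 2; the resulting square
  of the sum cancels the denominator. What remains is the original Beta integral times a ratio of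
  Gamma values, which is \<open>a * (a + 1)\<close> over \<open>c * (c + 1)\<close> with
  \<open>c = real n * a\<close>.\<close>

lemma nn_integral_dirichlet_square_ratio:
  assumes "0 < a" "0 < b" and i: "i \<in> {1..n}"
  shows "(\<integral>\<^sup>+x. ennreal (dirichlet_density n a b x) * ennreal ((x i)\<^sup>2 / (\<Sum>j=1..n. x j)\<^sup>2)
      \<partial>Pi\<^sub>M {1..n} (\<lambda>_. lborel)) = ennreal ((a + 1) / (real n * (real n * a + 1)))"
proof -
  let ?K = "Gamma (real n * a + b) / (Gamma a ^ n * Gamma b)"
  let ?a = "\<lambda>j. if j = i then a + 2 else a"
  let ?f = "\<lambda>s. power_kernel b (1 - s) * ennreal (1 / s\<^sup>2)"
  have n: "1 \<le> n" using i by simp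
  then have na: "0 < real n * a" using assms by simp
  have sum_a: "(\<Sum>j=1..n. ?a j) = real n * a + 2"
  proof -
    have "(\<Sum>j=1..n. ?a j) = (\<Sum>j=1..n. a + (if j = i then 2 else 0))"
      by (intro sum.cong) auto
    also have "\<dots> = real n * a + 2" using i by (simp add: sum.distrib)
    finally show ?thesis .
  qed
  have prod_a: "(\<Prod>j=1..n. Gamma (?a j)) = (a + 1) * a * Gamma a ^ n"
  proof -
    have "Gamma (a + 2) = (a + 1) * (a * Gamma a)"
      using assms by (intro Gamma_real_plus2)
    then have "(\<Prod>j=1..n. Gamma (?a j)) = (\<Prod>j=1..n. Gamma a * (if j = i then (a + 1) * a else 1))"
      by (intro prod.cong) auto
    also have "\<dots> = (a + 1) * a * Gamma a ^ n" using i by (simp add: prod.distrib)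
    finally show ?thesis .
  qed
  have kernel: "(\<Prod>j=1..n. power_kernel (?a j) (x j)) = ennreal ((x i)\<^sup>2) * (\<Prod>j=1..n. power_kernel a (x j))" for x
  proof -
    have "(\<Prod>j=1..n. power_kernel (?a j) (x j)) =
      (\<Prod>j=1..n. (if j = i then ennreal ((x i)\<^sup>2) else 1) * power_kernel a (x j))"
      by (intro prod.cong) (auto simp: power_kernel_add2)
    also have "\<dots> = ennreal ((x i)\<^sup>2) * (\<Prod>j=1..n. power_kernel a (x j))" using i by (simp add: prod.distrib)
    finally show ?thesis .
  qed
  have "(\<integral>\<^sup>+x. ennreal (dirichlet_density n a b x) * ennreal ((x i)\<^sup>2 / (\<Sum>j=1..n. x j)\<^sup>2)
      \<partial>Pi\<^sub>M {1..n} (\<lambda>_. lborel)) =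
    (\<integral>\<^sup>+x. ennreal ?K * ((\<Prod>j=1..n. power_kernel (?a j) (x j)) * ?f (\<Sum>j=1..n. x j)) \<partial>Pi\<^sub>M {1..n} (\<lambda>_. lborel))"
  proof (rule nn_integral_cong)
    fix x :: "nat \<Rightarrow> real"
    have "ennreal ((x i)\<^sup>2 / (\<Sum>j=1..n. x j)\<^sup>2) = ennreal ((x i)\<^sup>2) * ennreal (1 / (\<Sum>j=1..n. x j)\<^sup>2)"
      by (simp flip: ennreal_mult')
    then show "ennreal (dirichlet_density n a b x) * ennreal ((x i)\<^sup>2 / (\<Sum>j=1..n. x j)\<^sup>2) =
        ennreal ?K * ((\<Prod>j=1..n. power_kernel (?a j) (x j)) * ?f (\<Sum>j=1..n. x j))"
      unfolding kernel dirichlet_density_eq_power_kernel[OF assms(1,2)] by (simp only: mult_ac)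
  qed
  also have "\<dots> = ennreal ?K * (ennreal ((\<Prod>j=1..n. Gamma (?a j)) / Gamma (\<Sum>j=1..n. ?a j)) *
      (\<integral>\<^sup>+s. power_kernel (\<Sum>j=1..n. ?a j) s * ?f s \<partial>lborel))"
    using assms
    by (subst nn_integral_cmult, measurable, subst Liouville_integral[of "{1..n}" ?a ?f]) auto
  also have "(\<integral>\<^sup>+s. power_kernel (\<Sum>j=1..n. ?a j) s * ?f s \<partial>lborel) =
      (\<integral>\<^sup>+s. power_kernel (real n * a) s * power_kernel b (1 - s) \<partial>lborel)"
  proof (rule nn_integral_cong)
    fix s :: real
    \<comment> \<open>At \<open>s = 0\<close> division by zero gives 0 and the cancellation fails,
      but the kernel vanishes there.\<close>
    have "ennreal (s\<^sup>2) * ennreal (1 / s\<^sup>2) = 1 \<or> s = 0"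
      by (auto simp flip: ennreal_mult')
    then have "(ennreal (s\<^sup>2) * ennreal (1 / s\<^sup>2)) * power_kernel (real n * a) s = power_kernel (real n * a) s"
      by (auto simp: power_kernel_nonpos)
    moreover have "power_kernel (\<Sum>j=1..n. ?a j) s * ?f s =
        ((ennreal (s\<^sup>2) * ennreal (1 / s\<^sup>2)) * power_kernel (real n * a) s) * power_kernel b (1 - s)"
      unfolding sum_a power_kernel_add2 by (simp only: mult_ac)
    ultimately show "power_kernel (\<Sum>j=1..n. ?a j) s * ?f s = power_kernel (real n * a) s * power_kernel b (1 - s)"
      by (simp only:)
  qed
  also have "\<dots> = ennreal (Beta (real n * a) b)"
    using na assms by (intro nn_integral_power_kernel_Beta)
  also have "ennreal ?K * (ennreal ((\<Prod>j=1..n. Gamma (?a j)) / Gamma (\<Sum>j=1..n. ?a j)) * ennreal (Beta (real n * a) b)) =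
     ennreal (?K * ((a + 1) * a * Gamma a ^ n / Gamma (real n * a + 2) * Beta (real n * a) b))"
  proof -
    have "0 \<le> (a + 1) * a * Gamma a ^ n / Gamma (real n * a + 2)" "0 \<le> Beta (real n * a) b"
      using assms na Beta_pos[OF na assms(2)]
      by (auto intro!: divide_nonneg_nonneg mult_nonneg_nonneg zero_le_power Gamma_real_nonneg add_pos_pos)
    then show ?thesis
      unfolding prod_a sum_a by (simp only: ennreal_mult'' mult_nonneg_nonneg)
  qed
  also have "?K * ((a + 1) * a * Gamma a ^ n / Gamma (real n * a + 2) * Beta (real n * a) b) =
     (a + 1) / (real n * (real n * a + 1))"
  proof -
    have *: "Gamma a \<noteq> 0" "Gamma b \<noteq> 0" "Gamma (real n * a) \<noteq> 0" "Gamma (real n * a + b) \<noteq> 0"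
      using assms na by (simp_all add: less_imp_neq[symmetric] add_pos_pos)
    have "Gamma (real n * a + 2) = (real n * a + 1) * (real n * a * Gamma (real n * a))"
      using na by (intro Gamma_real_plus2)
    with * na n assms show ?thesis
      by (simp add: Beta_def divide_simps)
  qed
  finally show ?thesis .
qed

text \<open>The largest coordinate dominates \<open>(\<Sum>x\<^sub>i\<^sup>2) / (\<Sum>x\<^sub>i)\<close>, and the mean of
  \<open>(\<Sum>x\<^sub>i\<^sup>2) / (\<Sum>x\<^sub>i)\<^sup>2\<close> is close to \<open>1\<close>, so the bound is Markov's inequality.\<close>

lemma dirichlet_Max_less_half_sum:
  assumes "1 \<le> n" "0 < a" "0 < b"
  shows "(\<integral>\<^sup>+x. ennreal (dirichlet_density n a b x) *
      indicator {x. Max (x ` {1..n}) < (\<Sum>i=1..n. x i) / 2} x \<partial>Pi\<^sub>M {1..n} (\<lambda>_. lborel)) \<le> ennreal (2 * (real n * a))"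
proof -
  let ?L = "Pi\<^sub>M {1..n} (\<lambda>_. lborel :: real measure)"
  let ?D = "\<lambda>x. ennreal (dirichlet_density n a b x)"
  let ?S = "\<lambda>x::nat \<Rightarrow> real. \<Sum>i=1..n. x i"
  let ?Q = "\<lambda>x::nat \<Rightarrow> real. \<Sum>i=1..n. (x i)\<^sup>2 / (?S x)\<^sup>2"
  let ?q = "(a + 1) / (real n * a + 1)"
  have Q_nonneg: "0 \<le> ?Q x" for x by (intro sum_nonneg) auto
  have nonneg: "\<forall>i\<in>{1..n}. 0 \<le> x i" if "?D x \<noteq> 0" for x
    using that by (auto simp: dirichlet_density_def split: if_splits)
  \<comment> \<open>Each square is at most the maximum times the coordinate. The quotient by the
    squared sum stays valid for a zero sum, where both sides are 0.\<close>
  have Q_le: "?Q x \<le> Max (x ` {1..n}) * ?S x / (?S x)\<^sup>2" if "\<forall>i\<in>{1..n}. 0 \<le> x i" for x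
  proof -
    have "(\<Sum>i=1..n. (x i)\<^sup>2) \<le> (\<Sum>i=1..n. Max (x ` {1..n}) * x i)"
      using that unfolding power2_eq_square by (intro sum_mono mult_right_mono Max_ge) auto
    then show ?thesis
      by (simp add: sum_divide_distrib[symmetric] sum_distrib_left[symmetric] divide_right_mono)
  qed
  have Max_le: "Max (x ` {1..n}) \<le> ?S x" if "\<forall>i\<in>{1..n}. 0 \<le> x i" for x
    using that assms(1) by (auto intro!: member_le_sum)
  have Q_le1: "?Q x \<le> 1" if "\<forall>i\<in>{1..n}. 0 \<le> x i" for x
  proof -
    have "Max (x ` {1..n}) * ?S x / (?S x)\<^sup>2 \<le> ?S x * ?S x / (?S x)\<^sup>2"
      using that by (intro divide_right_mono mult_right_mono Max_le sum_nonneg) auto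
    also have "\<dots> \<le> 1" by (simp add: power2_eq_square)
    finally show ?thesis using Q_le[OF that] by simp
  qed
  have "(\<integral>\<^sup>+x. ?D x * ennreal (?Q x) \<partial>?L) = (\<Sum>i=1..n. ennreal ((a + 1) / (real n * (real n * a + 1))))"
  proof -
    have "(\<integral>\<^sup>+x. ?D x * ennreal (?Q x) \<partial>?L) =
        (\<integral>\<^sup>+x. (\<Sum>i=1..n. ?D x * ennreal ((x i)\<^sup>2 / (?S x)\<^sup>2)) \<partial>?L)"
      by (simp add: sum_ennreal[symmetric] sum_distrib_left del: sum_ennreal)
    also have "\<dots> = (\<Sum>i=1..n. \<integral>\<^sup>+x. ?D x * ennreal ((x i)\<^sup>2 / (?S x)\<^sup>2) \<partial>?L)"
      by (intro nn_integral_sum) measurable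
    also have "\<dots> = (\<Sum>i=1..n. ennreal ((a + 1) / (real n * (real n * a + 1))))"
      using assms by (intro sum.cong nn_integral_dirichlet_square_ratio) auto
    finally show ?thesis .
  qed
  also have "\<dots> = ennreal ?q"
    using assms by (simp add: ennreal_of_nat_eq_real_of_nat flip: ennreal_mult')
  finally have mean: "(\<integral>\<^sup>+x. ?D x * ennreal (?Q x) \<partial>?L) = ennreal ?q" .
  \<comment> \<open>Where the density is positive, \<open>?Q x\<close> lies between 0 and 1, so the
    integrals of \<open>1 - ?Q x\<close> and \<open>?Q x\<close> add up to the total mass 1, and the
    finite mean of \<open>?Q x\<close> can be cancelled.\<close>
  have "(\<integral>\<^sup>+x. ?D x * ennreal (1 - ?Q x) \<partial>?L) + ennreal ?q =
    (\<integral>\<^sup>+x. ?D x * ennreal (1 - ?Q x) + ?D x * ennreal (?Q x) \<partial>?L)"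
    unfolding mean[symmetric] by (intro nn_integral_add[symmetric]) measurable
  also have "\<dots> = (\<integral>\<^sup>+x. ?D x \<partial>?L)"
  proof (rule nn_integral_cong)
    fix x
    show "?D x * ennreal (1 - ?Q x) + ?D x * ennreal (?Q x) = ?D x"
    proof (cases "?D x = 0")
      case False
      then have "ennreal (1 - ?Q x) + ennreal (?Q x) = 1"
        using Q_le1[OF nonneg[OF False]] Q_nonneg[of x] by (subst ennreal_plus[symmetric]) auto
      then show ?thesis by (metis distrib_left mult.right_neutral)
    qed simp
  qed
  also have "\<dots> = 1" using assms by (rule nn_integral_dirichlet)
  finally have "(\<integral>\<^sup>+x. ?D x * ennreal (1 - ?Q x) \<partial>?L) + ennreal ?q = 1" .
  then have "(\<integral>\<^sup>+x. ?D x * ennreal (1 - ?Q x) \<partial>?L) = 1 - ennreal ?q"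
    using ennreal_add_diff_cancel_right[OF ennreal_neq_top, of "\<integral>\<^sup>+x. ?D x * ennreal (1 - ?Q x) \<partial>?L" ?q]
    by (simp only:)
  also have "\<dots> = ennreal (1 - ?q)"
    using assms by (simp add: ennreal_minus flip: ennreal_1)
  also have "1 - ?q = (real n * a - a) / (real n * a + 1)"
    using assms by (simp add: field_simps add_pos_pos less_imp_neq[symmetric])
  also have "ennreal \<dots> \<le> ennreal (real n * a)"
  proof (rule ennreal_leI)
    have "(real n * a - a) / (real n * a + 1) \<le> (real n * a) / 1"
      using assms by (intro frac_le) auto
    then show "(real n * a - a) / (real n * a + 1) \<le> real n * a" by simp
  qed
  finally have bound: "(\<integral>\<^sup>+x. ?D x * ennreal (1 - ?Q x) \<partial>?L) \<le> ennreal (real n * a)" .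
  \<comment> \<open>Markov's inequality: on the event, \<open>?Q x\<close> is at most the maximum
    over the sum, hence at most 1/2, so \<open>2 * (1 - ?Q x)\<close> is at least 1. The strict
    inequality in the event forces a positive sum.\<close>
  have "(\<integral>\<^sup>+x. ?D x * indicator {x. Max (x ` {1..n}) < ?S x / 2} x \<partial>?L) \<le>
     (\<integral>\<^sup>+x. 2 * (?D x * ennreal (1 - ?Q x)) \<partial>?L)"
  proof (rule nn_integral_mono)
    fix x
    show "?D x * indicator {x. Max (x ` {1..n}) < ?S x / 2} x \<le> 2 * (?D x * ennreal (1 - ?Q x))"
    proof (cases "?D x \<noteq> 0 \<and> Max (x ` {1..n}) < ?S x / 2")
      case True
      then have nn: "\<forall>i\<in>{1..n}. 0 \<le> x i" using nonneg by blast
      have "0 \<le> x 1" "x 1 \<le> Max (x ` {1..n})" using nn assms(1) by (auto intro!: Max_ge)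
      then have S: "0 < ?S x" using True by linarith
      have "?Q x \<le> Max (x ` {1..n}) / ?S x" using Q_le[OF nn] S by (simp add: power2_eq_square)
      also have "\<dots> \<le> 1 / 2" using True S by (simp add: field_simps)
      finally have "1 \<le> 2 * ennreal (1 - ?Q x)"
        by (simp add: ennreal_mult'[symmetric] flip: ennreal_numeral ennreal_1)
      then have "?D x * 1 \<le> ?D x * (2 * ennreal (1 - ?Q x))" by (intro mult_left_mono) auto
      then show ?thesis using True by (simp add: mult_ac)
    qed auto
  qed
  also have "\<dots> = 2 * (\<integral>\<^sup>+x. ?D x * ennreal (1 - ?Q x) \<partial>?L)"
    by (intro nn_integral_cmult) measurable
  also have "\<dots> \<le> 2 * ennreal (real n * a)" by (intro mult_left_mono bound) auto
  also have "\<dots> = ennreal (2 * (real n * a))" using assms by (simp add: ennreal_mult')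
  finally show ?thesis .
qed

section \<open>Asymptotics of the Beta distribution function\<close>

text \<open>Both bounds combine convexity of \<open>ln (Gamma x)\<close> with the recursion
  \<open>Gamma (x + 1) = x * Gamma x\<close>: the upper one places \<open>z + c\<close> between
  \<open>z\<close> and \<open>z + 1\<close>, the lower one places \<open>z + 1\<close> between
  \<open>z + c\<close> and \<open>z + c + 1\<close>.\<close>

lemma Gamma_ratio_bounds:
  fixes z c :: real
  assumes z: "1 \<le> z" and c: "0 < c" "c < 1"
  shows "z powr c / (1 + c) \<le> Gamma (z + c) / Gamma z" "Gamma (z + c) / Gamma z \<le> z powr c"
proof -
  define g :: "real \<Rightarrow> real" where "g \<equiv> \<lambda>x. ln (Gamma x)"
  have convex: "g ((1 - t) * x + t * y) \<le> (1 - t) * g x + t * g y"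
    if "0 \<le> t" "t \<le> 1" "0 < x" "0 < y" for t x y
    using convex_onD[OF log_convex_Gamma_real, of t x y] that by (simp add: g_def)
  have g_plus1: "g (x + 1) = ln x + g x" if "0 < x" for x
    using that Gamma_real_plus1[of x] Gamma_real_pos[OF that] by (simp add: g_def ln_mult_pos)
  have ratio: "Gamma (z + c) / Gamma z = exp (g (z + c) - g z)"
    using z c by (simp add: g_def exp_diff)
  have "g (z + c) \<le> (1 - c) * g z + c * g (z + 1)"
    using convex[of c z "z + 1"] z c by (simp add: algebra_simps)
  then have "g (z + c) - g z \<le> c * ln z"
    using g_plus1[of z] z by (simp add: algebra_simps)
  then show "Gamma (z + c) / Gamma z \<le> z powr c"
    unfolding ratio powr_def using z by simp
  have "(1 - c) * (z + c + 1) + c * (z + c) = z + 1" by (simp add: algebra_simps)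
  then have "g (z + 1) \<le> (1 - c) * g (z + c + 1) + c * g (z + c)"
    using convex[of c "z + c + 1" "z + c"] z c by simp
  then have 1: "ln z + g z \<le> g (z + c) + (1 - c) * ln (z + c)"
    using g_plus1[of z] g_plus1[of "z + c"] z c by (simp add: algebra_simps)
  \<comment> \<open>Here \<open>z \<ge> 1\<close> gives \<open>c \<le> z * c\<close>. The whole loss
    in the lower bound becomes the factor \<open>1 + c\<close>, uniform in \<open>z\<close>.\<close>
  have "z + c \<le> z * (1 + c)" using z c by (simp add: algebra_simps)
  then have "ln (z + c) \<le> ln (z * (1 + c))" using z c by (intro ln_mono) auto
  then have "(1 - c) * ln (z + c) \<le> (1 - c) * (ln z + ln (1 + c))"
    using z c by (intro mult_left_mono) (auto simp: ln_mult)
  moreover have "(1 - c) * ln (1 + c) \<le> 1 * ln (1 + c)"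
    using c by (intro mult_right_mono) auto
  ultimately have "c * ln z - ln (1 + c) \<le> g (z + c) - g z"
    using 1 by (simp add: algebra_simps)
  then have "exp (c * ln z - ln (1 + c)) \<le> exp (g (z + c) - g z)" by simp
  then show "z powr c / (1 + c) \<le> Gamma (z + c) / Gamma z"
    unfolding ratio using z c by (simp add: exp_diff powr_def)
qed

text \<open>Distribution function of the Beta law, the normalised incomplete Beta function, valid
  for every real \<open>y\<close> since the kernels vanish outside the unit interval. For positive
  parameters the integral is finite, so \<open>enn2real\<close> loses nothing.\<close>

definition beta_cdf :: "real \<Rightarrow> real \<Rightarrow> real \<Rightarrow> real" where
  "beta_cdf c b y = enn2real (ennreal (1 / Beta c b) *
     (\<integral>\<^sup>+s. power_kernel c s * power_kernel b (1 - s) * indicator {..y} s \<partial>lborel))"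

lemma ennreal_beta_cdf:
  assumes "0 < c" "0 < b"
  shows "ennreal (beta_cdf c b y) = ennreal (1 / Beta c b) *
     (\<integral>\<^sup>+s. power_kernel c s * power_kernel b (1 - s) * indicator {..y} s \<partial>lborel)"
proof -
  have "(\<integral>\<^sup>+s. power_kernel c s * power_kernel b (1 - s) * indicator {..y} s \<partial>lborel) \<le> ennreal (Beta c b)"
    unfolding nn_integral_power_kernel_Beta[OF assms, symmetric]
    by (intro nn_integral_mono) (auto split: split_indicator)
  then have "(\<integral>\<^sup>+s. power_kernel c s * power_kernel b (1 - s) * indicator {..y} s \<partial>lborel) < top"
    using ennreal_less_top le_less_trans by blast
  then show ?thesis
    unfolding beta_cdf_def by (intro ennreal_enn2real) (simp add: ennreal_mult_less_top)
qed

lemma nn_integral_power_kernel_atMost: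
  assumes "0 < c" "0 \<le> y"
  shows "(\<integral>\<^sup>+s. power_kernel c s * indicator {..y} s \<partial>lborel) = ennreal (y powr c / c)"
proof -
  have "((\<lambda>s. s powr (c - 1)) has_integral (y powr c / c)) {0..y}"
    using has_integral_powr_from_0[of "c - 1" y] assms by simp
  then have "(\<integral>\<^sup>+s. ennreal (indicator {0..y} s * s powr (c - 1)) \<partial>lborel) = ennreal (y powr c / c)"
    by (intro nn_integral_has_integral_lebesgue) auto
  moreover have "power_kernel c s * indicator {..y} s = ennreal (indicator {0..y} s * s powr (c - 1))" for s
    by (auto simp: power_kernel_def split: split_indicator)
  ultimately show ?thesis by simp
qed

text \<open>For \<open>0 < s \<le> y\<close> the factor \<open>(1 - s) powr (b - 1)\<close> is
  monotone in \<open>s\<close> and lies between its end values 1 and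
  \<open>(1 - y) powr (b - 1)\<close>; \<open>min\<close> and \<open>max\<close> treat
  \<open>b \<ge> 1\<close> and \<open>b < 1\<close> together. Pulling it out leaves the integral
  \<open>y powr c / c\<close>.\<close>

lemma beta_cdf_bounds:
  assumes c: "0 < c" and b: "0 < b" and y: "0 < y" "y < 1"
  shows "y powr c / (c * Beta c b) * min 1 ((1 - y) powr (b - 1)) \<le> beta_cdf c b y"
    and "beta_cdf c b y \<le> y powr c / (c * Beta c b) * max 1 ((1 - y) powr (b - 1))"
proof -
  let ?m = "(1 - y) powr (b - 1)"
  let ?I = "\<integral>\<^sup>+s. power_kernel c s * power_kernel b (1 - s) * indicator {..y} s \<partial>lborel"
  have B: "0 < Beta c b" using Beta_pos[OF c b] .
  have kernel: "ennreal (min 1 ?m) \<le> power_kernel b (1 - s) \<and> power_kernel b (1 - s) \<le> ennreal (max 1 ?m)"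
    if "0 < s" "s \<le> y" for s
  proof -
    have pk: "power_kernel b (1 - s) = ennreal ((1 - s) powr (b - 1))"
      using that y by (simp add: power_kernel_def)
    have "min 1 ?m \<le> (1 - s) powr (b - 1) \<and> (1 - s) powr (b - 1) \<le> max 1 ?m"
    proof (cases "1 \<le> b")
      case True
      then have "?m \<le> (1 - s) powr (b - 1)" "(1 - s) powr (b - 1) \<le> 1 powr (b - 1)"
        using that y by (intro powr_mono2; simp)+
      then show ?thesis by auto
    next
      case False
      then have "1 powr (b - 1) \<le> (1 - s) powr (b - 1)" "(1 - s) powr (b - 1) \<le> ?m"
        using that y by (intro powr_mono2'; simp)+
      then show ?thesis by auto
    qed
    then show ?thesis unfolding pk by (auto intro: ennreal_leI)
  qed
  have weight: "ennreal (1 / Beta c b) * (ennreal r * (\<integral>\<^sup>+s. power_kernel c s * indicator {..y} s \<partial>lborel)) =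
      ennreal (y powr c / (c * Beta c b) * r)" if "0 \<le> r" for r
    using c y B that
    by (simp add: nn_integral_power_kernel_atMost ennreal_mult'[symmetric] mult_ac)
  have "ennreal (min 1 ?m) * (\<integral>\<^sup>+s. power_kernel c s * indicator {..y} s \<partial>lborel) =
      (\<integral>\<^sup>+s. ennreal (min 1 ?m) * (power_kernel c s * indicator {..y} s) \<partial>lborel)"
    by (intro nn_integral_cmult[symmetric]) measurable
  also have "\<dots> \<le> ?I"
  proof (rule nn_integral_mono)
    fix s :: real
    show "ennreal (min 1 ?m) * (power_kernel c s * indicator {..y} s) \<le>
        power_kernel c s * power_kernel b (1 - s) * indicator {..y} s"
    proof (cases "0 < s \<and> s \<le> y")
      case True
      then show ?thesis using mult_left_mono[OF conjunct1[OF kernel[of s]], of "power_kernel c s"]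
        by (simp add: mult_ac)
    qed (auto simp: power_kernel_nonpos)
  qed
  finally have "ennreal (1 / Beta c b) * (ennreal (min 1 ?m) * (\<integral>\<^sup>+s. power_kernel c s * indicator {..y} s \<partial>lborel)) \<le>
      ennreal (1 / Beta c b) * ?I" by (intro mult_left_mono) auto
  then have "ennreal (y powr c / (c * Beta c b) * min 1 ?m) \<le> ennreal (beta_cdf c b y)"
    unfolding ennreal_beta_cdf[OF c b] by (subst (asm) weight) auto
  then show "y powr c / (c * Beta c b) * min 1 ?m \<le> beta_cdf c b y"
    by (simp add: beta_cdf_def)
  have "?I \<le> (\<integral>\<^sup>+s. ennreal (max 1 ?m) * (power_kernel c s * indicator {..y} s) \<partial>lborel)"
  proof (rule nn_integral_mono)
    fix s :: real
    show "power_kernel c s * power_kernel b (1 - s) * indicator {..y} s \<le>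
        ennreal (max 1 ?m) * (power_kernel c s * indicator {..y} s)"
    proof (cases "0 < s \<and> s \<le> y")
      case True
      then show ?thesis using mult_left_mono[OF conjunct2[OF kernel[of s]], of "power_kernel c s"]
        by (simp add: mult_ac)
    qed (auto simp: power_kernel_nonpos)
  qed
  also have "\<dots> = ennreal (max 1 ?m) * (\<integral>\<^sup>+s. power_kernel c s * indicator {..y} s \<partial>lborel)"
    by (intro nn_integral_cmult) measurable
  finally have "ennreal (1 / Beta c b) * ?I \<le>
      ennreal (1 / Beta c b) * (ennreal (max 1 ?m) * (\<integral>\<^sup>+s. power_kernel c s * indicator {..y} s \<partial>lborel))"
    by (intro mult_left_mono) auto
  then have "ennreal (beta_cdf c b y) \<le> ennreal (y powr c / (c * Beta c b) * max 1 ?m)"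
    unfolding ennreal_beta_cdf[OF c b] by (subst (asm) weight) auto
  then show "beta_cdf c b y \<le> y powr c / (c * Beta c b) * max 1 ?m"
    using c B by (subst (asm) ennreal_le_iff) auto
qed

text \<open>The bounds leave a main term \<open>w\<close>, tending to \<open>p * x\<close>, and a
  correction \<open>m\<close>, tending to 1. The hypothesis on \<open>(b n + 1) / \<sigma> n\<close>
  says that its power \<open>c n\<close> tends to 1, which serves both choices of normalisation;
  \<open>k\<close> disappears because \<open>k powr c n\<close> tends to 1.\<close>

lemma beta_cdf_tendsto:
  fixes c b \<sigma> :: "nat \<Rightarrow> real"
  assumes pos: "eventually (\<lambda>n. 0 < c n \<and> 0 < b n \<and> 0 < \<sigma> n) sequentially"
    and c: "c \<longlonglongrightarrow> 0"
    and \<sigma>: "(\<lambda>n. c n * ln ((b n + 1) / \<sigma> n)) \<longlonglongrightarrow> 0"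
    and p: "(\<lambda>n. 1 / (1 + c n / b n)) \<longlonglongrightarrow> p"
    and k: "0 < k" and x: "0 < x" "x < 1"
  shows "(\<lambda>n. beta_cdf (c n) (b n) (k * x powr (1 / c n) / \<sigma> n)) \<longlonglongrightarrow> p * x"
proof -
  define y where "y n = k * x powr (1 / c n) / \<sigma> n" for n
  define w where "w n = y n powr c n / (c n * Beta (c n) (b n))" for n
  define m where "m n = (1 - y n) powr (b n - 1)" for n
  have y_pos: "eventually (\<lambda>n. 0 < y n) sequentially"
    using pos by eventually_elim (use k x in \<open>simp add: y_def\<close>)
  have c_right: "filterlim c (at_right 0) sequentially"
    using c pos by (auto simp: filterlim_at elim: eventually_mono)
  \<comment> \<open>Up to the factor \<open>k\<close>, the logarithm is a quotient by
    \<open>c n\<close> whose numerator tends to \<open>ln x < 0\<close>, so it tends to minus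
    infinity. The weight \<open>b n + 1\<close> is kept because the exponent \<open>b n - 1\<close>
    in \<open>m n\<close> may be unbounded.\<close>
  have by0: "(\<lambda>n. (b n + 1) * y n) \<longlonglongrightarrow> 0"
  proof -
    have "(\<lambda>n. ln x + c n * ln ((b n + 1) / \<sigma> n)) \<longlonglongrightarrow> ln x + 0"
      by (intro tendsto_intros \<sigma>)
    moreover have "filterlim (\<lambda>n. inverse (c n)) at_top sequentially"
      by (rule filterlim_compose[OF filterlim_inverse_at_top_right c_right])
    ultimately have "filterlim (\<lambda>n. (ln x + c n * ln ((b n + 1) / \<sigma> n)) * inverse (c n)) at_bot sequentially"
      using x by (intro filterlim_tendsto_neg_mult_at_bot[where c = "ln x + 0"]) auto
    then have "(\<lambda>n. k * exp ((ln x + c n * ln ((b n + 1) / \<sigma> n)) * inverse (c n))) \<longlonglongrightarrow> k * 0"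
      by (intro tendsto_mult tendsto_const filterlim_compose[OF exp_at_bot])
    moreover have "eventually (\<lambda>n. k * exp ((ln x + c n * ln ((b n + 1) / \<sigma> n)) * inverse (c n)) = (b n + 1) * y n) sequentially"
      using pos
    proof eventually_elim
      case (elim n)
      then have "(ln x + c n * ln ((b n + 1) / \<sigma> n)) * inverse (c n) = ln x / c n + ln ((b n + 1) / \<sigma> n)"
        by (simp add: field_simps)
      also have "exp \<dots> = x powr (1 / c n) * ((b n + 1) / \<sigma> n)"
        using elim x by (simp add: exp_add powr_def)
      finally show ?case by (simp add: y_def)
    qed
    ultimately show ?thesis by (auto intro: Lim_transform_eventually)
  qed
  have y0: "y \<longlonglongrightarrow> 0"
  proof (rule tendsto_sandwich[OF _ _ tendsto_const by0])
    show "eventually (\<lambda>n. 0 \<le> y n) sequentially" using y_pos by eventually_elim simp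
    show "eventually (\<lambda>n. y n \<le> (b n + 1) * y n) sequentially"
      using pos y_pos by eventually_elim (simp add: algebra_simps)
  qed
  have y_half: "eventually (\<lambda>n. y n < 1 / 2) sequentially"
    using order_tendstoD(2)[OF y0, of "1/2"] by simp
  have "(\<lambda>n. (b n - 1) * ln (1 - y n)) \<longlonglongrightarrow> 0"
  proof (rule Lim_null_comparison)
    \<comment> \<open>For \<open>0 < y n < 1 / 2\<close> the logarithm of \<open>1 - y n\<close> is
      at most \<open>2 * y n\<close> in absolute value.\<close>
    show "eventually (\<lambda>n. norm ((b n - 1) * ln (1 - y n)) \<le> 2 * ((b n + 1) * y n)) sequentially"
      using pos y_pos y_half
    proof eventually_elim
      case (elim n)
      then have "- y n - 2 * (y n)\<^sup>2 \<le> ln (1 - y n)" by (intro ln_one_minus_pos_lower_bound) auto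
      moreover have "(y n)\<^sup>2 \<le> y n * (1 / 2)" using elim unfolding power2_eq_square by (intro mult_left_mono) auto
      ultimately have "\<bar>ln (1 - y n)\<bar> \<le> 2 * y n" using elim by simp
      moreover have "\<bar>b n - 1\<bar> \<le> b n + 1" using elim by linarith
      ultimately have "\<bar>b n - 1\<bar> * \<bar>ln (1 - y n)\<bar> \<le> (b n + 1) * (2 * y n)"
        using elim by (intro mult_mono) auto
      then show ?case by (simp add: abs_mult)
    qed
    show "(\<lambda>n. 2 * ((b n + 1) * y n)) \<longlonglongrightarrow> 0" using tendsto_mult_right_zero[OF by0] .
  qed
  then have "(\<lambda>n. exp ((b n - 1) * ln (1 - y n))) \<longlonglongrightarrow> 1" using tendsto_exp by fastforce
  then have m: "m \<longlonglongrightarrow> 1"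
  proof (rule Lim_transform_eventually)
    show "eventually (\<lambda>n. exp ((b n - 1) * ln (1 - y n)) = m n) sequentially"
      using y_half by eventually_elim (simp add: m_def powr_def)
  qed
  have w: "w \<longlonglongrightarrow> p * x"
  proof -
    \<comment> \<open>The Gamma ratio is taken at \<open>b n + 1\<close>, so that the bounds for
      arguments at least 1 apply even if \<open>b n\<close> tends to 0. The shift from
      \<open>b n\<close> produces the factor \<open>b n / (b n + c n) = 1 / (1 + c n / b n)\<close>,
      the source of \<open>p\<close>.\<close>
    define g where "g n = Gamma (b n + 1 + c n) / Gamma (b n + 1) / \<sigma> n powr c n" for n
    have "(\<lambda>n. exp (c n * ln ((b n + 1) / \<sigma> n))) \<longlonglongrightarrow> 1" using tendsto_exp[OF \<sigma>] by simp
    then have r: "(\<lambda>n. ((b n + 1) / \<sigma> n) powr c n) \<longlonglongrightarrow> 1"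
    proof (rule Lim_transform_eventually)
      show "eventually (\<lambda>n. exp (c n * ln ((b n + 1) / \<sigma> n)) = ((b n + 1) / \<sigma> n) powr c n) sequentially"
        using pos by eventually_elim (auto simp: powr_def)
    qed
    have c1: "eventually (\<lambda>n. c n < 1) sequentially" using order_tendstoD(2)[OF c, of 1] by simp
    have g: "g \<longlonglongrightarrow> 1"
    proof (rule tendsto_sandwich[OF _ _ _ r])
      show "eventually (\<lambda>n. ((b n + 1) / \<sigma> n) powr c n / (1 + c n) \<le> g n) sequentially"
        using pos c1
      proof eventually_elim
        case (elim n)
        then have "(b n + 1) powr c n / (1 + c n) / \<sigma> n powr c n \<le> g n"
          unfolding g_def by (intro divide_right_mono Gamma_ratio_bounds) auto
        then show ?case using elim by (simp add: powr_divide mult_ac)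
      qed
      show "eventually (\<lambda>n. g n \<le> ((b n + 1) / \<sigma> n) powr c n) sequentially"
        using pos c1
      proof eventually_elim
        case (elim n)
        then have "g n \<le> (b n + 1) powr c n / \<sigma> n powr c n"
          unfolding g_def by (intro divide_right_mono Gamma_ratio_bounds) auto
        then show ?case using elim by (simp add: powr_divide)
      qed
      have "(\<lambda>n. ((b n + 1) / \<sigma> n) powr c n / (1 + c n)) \<longlonglongrightarrow> 1 / (1 + 0)"
        by (intro tendsto_intros r c) auto
      then show "(\<lambda>n. ((b n + 1) / \<sigma> n) powr c n / (1 + c n)) \<longlonglongrightarrow> 1" by simp
    qed
    have Gamma1: "(\<lambda>n. Gamma (c n + 1)) \<longlonglongrightarrow> Gamma (0 + 1)"
      by (intro tendsto_Gamma tendsto_intros c) auto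
    have k1: "(\<lambda>n. k powr c n) \<longlonglongrightarrow> k powr 0"
      using k by (intro tendsto_powr tendsto_const c) auto
    have "(\<lambda>n. 1 / (1 + c n / b n) * x * (k powr c n * g n / Gamma (c n + 1))) \<longlonglongrightarrow>
        p * x * (k powr 0 * 1 / Gamma (0 + 1))"
      by (intro tendsto_intros p k1 g Gamma1) auto
    then have "(\<lambda>n. 1 / (1 + c n / b n) * x * (k powr c n * g n / Gamma (c n + 1))) \<longlonglongrightarrow> p * x"
      using k by simp
    then show ?thesis
    proof (rule Lim_transform_eventually)
      show "eventually (\<lambda>n. 1 / (1 + c n / b n) * x * (k powr c n * g n / Gamma (c n + 1)) = w n) sequentially"
        using pos
      proof eventually_elim
        case (elim n)
        have y: "y n powr c n = k powr c n * x / \<sigma> n powr c n"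
          using elim k x by (simp add: y_def powr_mult powr_divide powr_powr)
        define d where "d = b n + c n"
        have nz: "Gamma (c n) \<noteq> 0" "Gamma (b n) \<noteq> 0" "Gamma d \<noteq> 0" "\<sigma> n powr c n \<noteq> 0" "d \<noteq> 0"
          using elim by (simp_all add: d_def less_imp_neq[symmetric] add_pos_pos)
        have G: "Gamma (c n + 1) = c n * Gamma (c n)" "Gamma (b n + 1) = b n * Gamma (b n)"
          "Gamma (b n + 1 + c n) = d * Gamma d" "Gamma (c n + b n) = Gamma d"
          using Gamma_real_plus1[of "c n"] Gamma_real_plus1[of "b n"] Gamma_real_plus1[of d] elim
          by (simp_all add: d_def add_ac)
        have "1 / (1 + c n / b n) = b n / d" using elim by (simp add: d_def field_simps)
        then show ?case
          using nz elim unfolding w_def y g_def Beta_def G by (simp add: field_simps)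
      qed
    qed
  qed
  have "(\<lambda>n. beta_cdf (c n) (b n) (y n)) \<longlonglongrightarrow> p * x"
  proof (rule tendsto_sandwich)
    show "eventually (\<lambda>n. w n * min 1 (m n) \<le> beta_cdf (c n) (b n) (y n)) sequentially"
      using pos y_pos y_half by eventually_elim (simp only: w_def m_def, rule beta_cdf_bounds, auto)
    show "eventually (\<lambda>n. beta_cdf (c n) (b n) (y n) \<le> w n * max 1 (m n)) sequentially"
      using pos y_pos y_half by eventually_elim (simp only: w_def m_def, rule beta_cdf_bounds, auto)
    have "(\<lambda>n. w n * min 1 (m n)) \<longlonglongrightarrow> p * x * min 1 1" by (intro tendsto_intros w m)
    then show "(\<lambda>n. w n * min 1 (m n)) \<longlonglongrightarrow> p * x" by simp
    have "(\<lambda>n. w n * max 1 (m n)) \<longlonglongrightarrow> p * x * max 1 1" by (intro tendsto_intros w m)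
    then show "(\<lambda>n. w n * max 1 (m n)) \<longlonglongrightarrow> p * x" by simp
  qed
  then show ?thesis by (simp add: y_def)
qed

section \<open>Distribution functions of the scaled maximum and of the limit law\<close>

lemma dirichlet_density_nonzeroD:
  assumes "dirichlet_density n a b x \<noteq> 0"
  shows "\<And>i. i \<in> {1..n} \<Longrightarrow> 0 \<le> x i" "(\<Sum>i=1..n. x i) \<le> 1"
  using assms by (auto simp: dirichlet_density_def split: if_splits)

lemma Max_le_sum_of_nonneg:
  fixes x :: "nat \<Rightarrow> real"
  assumes "1 \<le> n" "\<And>i. i \<in> {1..n} \<Longrightarrow> 0 \<le> x i"
  shows "0 \<le> Max (x ` {1..n})" "Max (x ` {1..n}) \<le> (\<Sum>i=1..n. x i)"
proof -
  show "Max (x ` {1..n}) \<le> (\<Sum>i=1..n. x i)"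
    using assms by (auto intro!: member_le_sum)
  have "0 \<le> x 1" using assms by simp
  also have "\<dots> \<le> Max (x ` {1..n})" using assms by (intro Max_ge) auto
  finally show "0 \<le> Max (x ` {1..n})" .
qed

lemma measurable_Max_PiM [measurable]:
  fixes n :: nat
  shows "(\<lambda>x. Max (x ` {1..n})) \<in> borel_measurable (Pi\<^sub>M {1..n} (\<lambda>_. lborel :: real measure))"
  by (rule borel_measurable_Max) auto

lemma nn_integral_dirichlet_sum_le:
  assumes "1 \<le> n" "0 < a" "0 < b"
  shows "(\<integral>\<^sup>+x. ennreal (dirichlet_density n a b x) * indicator {x. (\<Sum>i=1..n. x i) \<le> y} x
     \<partial>Pi\<^sub>M {1..n} (\<lambda>_. lborel)) = ennreal (beta_cdf (real n * a) b y)"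
proof -
  have "indicator {x. (\<Sum>i=1..n. x i) \<le> y} x = (indicator {..y} (\<Sum>i=1..n. x i) :: ennreal)" for x
    by (auto split: split_indicator)
  then show ?thesis
    using nn_integral_dirichlet_sum[OF assms, of "indicator {..y}"] assms
    by (simp add: ennreal_beta_cdf)
qed

text \<open>The maximum is at most the sum where the density is positive, whence the lower bound. If
  the maximum is at most \<open>y\<close>, then the sum is at most \<open>2 * y\<close> or the
  maximum is below half the sum; the latter event has small mass.\<close>

lemma dirichlet_Max_le_bounds:
  assumes "1 \<le> n" "0 < a" "0 < b"
  shows "ennreal (beta_cdf (real n * a) b y) \<le>
      (\<integral>\<^sup>+x. ennreal (dirichlet_density n a b x) * indicator {x. Max (x ` {1..n}) \<le> y} x \<partial>Pi\<^sub>M {1..n} (\<lambda>_. lborel))"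
    and "(\<integral>\<^sup>+x. ennreal (dirichlet_density n a b x) * indicator {x. Max (x ` {1..n}) \<le> y} x \<partial>Pi\<^sub>M {1..n} (\<lambda>_. lborel))
      \<le> ennreal (beta_cdf (real n * a) b (2 * y)) + ennreal (2 * (real n * a))"
proof -
  let ?L = "Pi\<^sub>M {1..n} (\<lambda>_. lborel :: real measure)"
  let ?D = "\<lambda>x. ennreal (dirichlet_density n a b x)"
  let ?S = "\<lambda>x::nat \<Rightarrow> real. \<Sum>i=1..n. x i"
  show "ennreal (beta_cdf (real n * a) b y) \<le> (\<integral>\<^sup>+x. ?D x * indicator {x. Max (x ` {1..n}) \<le> y} x \<partial>?L)"
    unfolding nn_integral_dirichlet_sum_le[OF assms, symmetric]
  proof (rule nn_integral_mono)
    fix x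
    show "?D x * indicator {x. ?S x \<le> y} x \<le> ?D x * indicator {x. Max (x ` {1..n}) \<le> y} x"
    proof (cases "dirichlet_density n a b x = 0")
      case False
      have "Max (x ` {1..n}) \<le> ?S x"
        by (intro Max_le_sum_of_nonneg dirichlet_density_nonzeroD[OF False] assms)
      then show ?thesis by (auto split: split_indicator)
    qed simp
  qed
  have "(\<integral>\<^sup>+x. ?D x * indicator {x. Max (x ` {1..n}) \<le> y} x \<partial>?L) \<le>
    (\<integral>\<^sup>+x. ?D x * indicator {x. ?S x \<le> 2 * y} x + ?D x * indicator {x. Max (x ` {1..n}) < ?S x / 2} x \<partial>?L)"
    by (intro nn_integral_mono) (auto split: split_indicator)
  also have "\<dots> = (\<integral>\<^sup>+x. ?D x * indicator {x. ?S x \<le> 2 * y} x \<partial>?L) +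
     (\<integral>\<^sup>+x. ?D x * indicator {x. Max (x ` {1..n}) < ?S x / 2} x \<partial>?L)"
  proof (rule nn_integral_add)
    show "(\<lambda>x. ?D x * indicator {x. ?S x \<le> 2 * y} x) \<in> borel_measurable ?L"
      by measurable
    show "(\<lambda>x. ?D x * indicator {x. Max (x ` {1..n}) < ?S x / 2} x) \<in> borel_measurable ?L"
      by measurable
  qed
  also have "\<dots> \<le> ennreal (beta_cdf (real n * a) b (2 * y)) + ennreal (2 * (real n * a))"
    unfolding nn_integral_dirichlet_sum_le[OF assms] using assms
    by (intro add_left_mono dirichlet_Max_less_half_sum)
  finally show "(\<integral>\<^sup>+x. ?D x * indicator {x. Max (x ` {1..n}) \<le> y} x \<partial>?L) \<le>
     ennreal (beta_cdf (real n * a) b (2 * y)) + ennreal (2 * (real n * a))" .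
qed

section \<open>The law of the scaled maximum in a fixed dimension\<close>

context
  fixes n :: nat and a b \<sigma> :: real and M :: "'a measure" and X :: "nat \<Rightarrow> 'a \<Rightarrow> real"
    and law :: "real measure"
  assumes n: "1 \<le> n" and a: "0 < a" and b: "0 < b" and \<sigma>: "0 < \<sigma>"
    and dirichlet: "distributed M (Pi\<^sub>M {1..n} (\<lambda>_. lborel)) (\<lambda>\<omega>. \<lambda>i\<in>{1..n}. X i \<omega>)
        (\<lambda>x. ennreal (dirichlet_density n a b x))"
  defines "law \<equiv> distr M borel (\<lambda>\<omega>. (\<sigma> * Max ((\<lambda>i. X i \<omega>) ` {1..n})) powr (real n * a))"
begin

lemma scaled_Max_law_eq:
  "law = distr (density (Pi\<^sub>M {1..n} (\<lambda>_. lborel)) (\<lambda>x. ennreal (dirichlet_density n a b x))) borel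
     (\<lambda>x. (\<sigma> * Max (x ` {1..n})) powr (real n * a))"
proof -
  have T: "(\<lambda>\<omega>. \<lambda>i\<in>{1..n}. X i \<omega>) \<in> measurable M (Pi\<^sub>M {1..n} (\<lambda>_. lborel))"
    using dirichlet by (rule distributed_measurable)
  have "law = distr M borel ((\<lambda>x. (\<sigma> * Max (x ` {1..n})) powr (real n * a)) \<circ> (\<lambda>\<omega>. \<lambda>i\<in>{1..n}. X i \<omega>))"
    unfolding law_def comp_def
  proof (rule distr_cong)
    fix \<omega>
    have "(\<lambda>i\<in>{1..n}. X i \<omega>) ` {1..n} = (\<lambda>i. X i \<omega>) ` {1..n}" by (intro image_cong) auto
    then show "(\<sigma> * Max ((\<lambda>i. X i \<omega>) ` {1..n})) powr (real n * a) =
       (\<sigma> * Max ((\<lambda>i\<in>{1..n}. X i \<omega>) ` {1..n})) powr (real n * a)" by (simp only:)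
  qed auto
  also have "\<dots> = distr (distr M (Pi\<^sub>M {1..n} (\<lambda>_. lborel)) (\<lambda>\<omega>. \<lambda>i\<in>{1..n}. X i \<omega>)) borel
      (\<lambda>x. (\<sigma> * Max (x ` {1..n})) powr (real n * a))"
    by (intro distr_distr[symmetric] T) measurable
  also have "distr M (Pi\<^sub>M {1..n} (\<lambda>_. lborel)) (\<lambda>\<omega>. \<lambda>i\<in>{1..n}. X i \<omega>) =
      density (Pi\<^sub>M {1..n} (\<lambda>_. lborel)) (\<lambda>x. ennreal (dirichlet_density n a b x))"
    using dirichlet by (rule distributed_distr_eq_density)
  finally show ?thesis .
qed

lemma prob_space_scaled_Max_law: "prob_space law"
proof -
  let ?L = "Pi\<^sub>M {1..n} (\<lambda>_. lborel :: real measure)"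
  let ?D = "\<lambda>x. ennreal (dirichlet_density n a b x)"
  have "emeasure (density ?L ?D) (space ?L) = (\<integral>\<^sup>+x. ?D x * indicator (space ?L) x \<partial>?L)"
    by (rule emeasure_density) measurable
  also have "\<dots> = (\<integral>\<^sup>+x. ?D x \<partial>?L)" by (intro nn_integral_cong) simp
  also have "\<dots> = 1" by (rule nn_integral_dirichlet[OF n a b])
  finally have "prob_space (density ?L ?D)" by (intro prob_spaceI) (simp only: space_density)
  then show ?thesis unfolding scaled_Max_law_eq by (rule prob_space.prob_space_distr) measurable
qed

lemma emeasure_scaled_Max_law:
  "emeasure law {..x} = (\<integral>\<^sup>+v. ennreal (dirichlet_density n a b v) *
     indicator {v. (\<sigma> * Max (v ` {1..n})) powr (real n * a) \<le> x} v \<partial>Pi\<^sub>M {1..n} (\<lambda>_. lborel))"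
proof -
  let ?L = "Pi\<^sub>M {1..n} (\<lambda>_. lborel :: real measure)"
  let ?f = "\<lambda>v. (\<sigma> * Max (v ` {1..n})) powr (real n * a)"
  have "emeasure law {..x} = emeasure (density ?L (\<lambda>x. ennreal (dirichlet_density n a b x))) (?f -` {..x} \<inter> space ?L)"
    unfolding scaled_Max_law_eq by (subst emeasure_distr) auto
  also have "\<dots> = (\<integral>\<^sup>+v. ennreal (dirichlet_density n a b v) * indicator (?f -` {..x} \<inter> space ?L) v \<partial>?L)"
    by (rule emeasure_density) measurable
  also have "\<dots> = (\<integral>\<^sup>+v. ennreal (dirichlet_density n a b v) * indicator {v. ?f v \<le> x} v \<partial>?L)"
    by (intro nn_integral_cong) (auto split: split_indicator)
  finally show ?thesis .
qed

lemma cdf_scaled_Max_law_negative: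
  assumes "x < 0"
  shows "cdf law x = 0"
proof -
  have "\<not> r powr s \<le> x" for r s using assms powr_ge_zero[of r s] by linarith
  then show ?thesis unfolding cdf_def measure_def emeasure_scaled_Max_law by simp
qed

text \<open>Where the density is positive the maximum is nonnegative, and the power function is
  increasing there, so the event turns into a bound on the maximum by \<open>y\<close>.\<close>

lemma cdf_scaled_Max_law_bounds:
  assumes x: "0 < x"
  defines "y \<equiv> x powr (1 / (real n * a)) / \<sigma>"
  shows "beta_cdf (real n * a) b y \<le> cdf law x"
    and "cdf law x \<le> beta_cdf (real n * a) b (2 * y) + 2 * (real n * a)"
proof -
  interpret prob_space law by (rule prob_space_scaled_Max_law)
  have c: "0 < real n * a" using n a by simp
  have powr_le_iff: "u powr c \<le> w \<longleftrightarrow> u \<le> w powr (1 / c)" if "0 \<le> u" "0 < w" "0 < c" for u w c :: real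
    using powr_mono2[of c u "w powr (1 / c)"] powr_less_mono2[of c "w powr (1 / c)" u] that
    by (cases "u \<le> w powr (1 / c)") (auto simp: powr_powr)
  have "emeasure law {..x} = (\<integral>\<^sup>+v. ennreal (dirichlet_density n a b v) *
     indicator {v. Max (v ` {1..n}) \<le> y} v \<partial>Pi\<^sub>M {1..n} (\<lambda>_. lborel))"
    unfolding emeasure_scaled_Max_law
  proof (rule nn_integral_cong)
    fix v
    show "ennreal (dirichlet_density n a b v) * indicator {v. (\<sigma> * Max (v ` {1..n})) powr (real n * a) \<le> x} v =
      ennreal (dirichlet_density n a b v) * indicator {v. Max (v ` {1..n}) \<le> y} v"
    proof (cases "dirichlet_density n a b v = 0")
      case False
      define m where "m = Max (v ` {1..n})"
      have "0 \<le> m" unfolding m_def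
        by (intro Max_le_sum_of_nonneg dirichlet_density_nonzeroD[OF False] n)
      then have m: "0 \<le> \<sigma> * m" using \<sigma> by simp
      have "(\<sigma> * m) powr (real n * a) \<le> x \<longleftrightarrow> \<sigma> * m \<le> x powr (1 / (real n * a))"
        using m x c by (rule powr_le_iff)
      also have "\<dots> \<longleftrightarrow> m \<le> y" using \<sigma> by (simp add: y_def field_simps)
      finally show ?thesis by (simp add: m_def indicator_def)
    qed simp
  qed
  then have eq: "ennreal (cdf law x) = (\<integral>\<^sup>+v. ennreal (dirichlet_density n a b v) *
     indicator {v. Max (v ` {1..n}) \<le> y} v \<partial>Pi\<^sub>M {1..n} (\<lambda>_. lborel))"
    unfolding cdf_def by (simp add: emeasure_eq_measure)
  have nonneg: "0 \<le> beta_cdf c' b' y'" for c' b' y' by (simp add: beta_cdf_def)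
  show "beta_cdf (real n * a) b y \<le> cdf law x"
    using dirichlet_Max_le_bounds(1)[OF n a b, of y] unfolding eq[symmetric]
    by (simp add: cdf_def)
  have "ennreal (cdf law x) \<le> ennreal (beta_cdf (real n * a) b (2 * y) + 2 * (real n * a))"
    using dirichlet_Max_le_bounds(2)[OF n a b, of y] c nonneg[of "real n * a" b "2 * y"] unfolding eq[symmetric]
    by (subst ennreal_plus) auto
  then show "cdf law x \<le> beta_cdf (real n * a) b (2 * y) + 2 * (real n * a)"
    using c nonneg[of "real n * a" b "2 * y"] by (subst (asm) ennreal_le_iff) auto
qed

text \<open>The coordinate sum is at most 1 where the density is positive, hence so is the maximum.
  This locates the mass that the limit law places at 1, which limits at points \<open>x < 1\<close>
  cannot do.\<close>

lemma cdf_scaled_Max_law_ge_1: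
  assumes "\<sigma> = 1" "1 \<le> x"
  shows "cdf law x = 1"
proof -
  interpret prob_space law by (rule prob_space_scaled_Max_law)
  have "emeasure law {..x} = (\<integral>\<^sup>+v. ennreal (dirichlet_density n a b v) \<partial>Pi\<^sub>M {1..n} (\<lambda>_. lborel))"
    unfolding emeasure_scaled_Max_law
  proof (rule nn_integral_cong)
    fix v
    show "ennreal (dirichlet_density n a b v) * indicator {v. (\<sigma> * Max (v ` {1..n})) powr (real n * a) \<le> x} v =
      ennreal (dirichlet_density n a b v)"
    proof (cases "dirichlet_density n a b v = 0")
      case False
      note D = dirichlet_density_nonzeroD[OF False]
      have "0 \<le> Max (v ` {1..n})" "Max (v ` {1..n}) \<le> 1"
        using Max_le_sum_of_nonneg[of n v] n D by fastforce+
      then have "Max (v ` {1..n}) powr (real n * a) \<le> 1"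
        using n a by (intro powr_le1) auto
      then show ?thesis using assms by simp
    qed simp
  qed
  also have "\<dots> = 1" by (rule nn_integral_dirichlet[OF n a b])
  finally show ?thesis by (simp add: cdf_def measure_def)
qed

end

section \<open>The distribution function of the limit law\<close>

lemma one_divide_one_plus_ennreal: "0 \<le> r \<Longrightarrow> 1 / (1 + ennreal r) = ennreal (1 / (1 + r))"
  by (subst divide_ennreal[symmetric]) auto

lemma cdf_U_law:
  "cdf (U_law l) x = (if x < 0 then 0 else if x < 1 then enn2real (1 / (1 + l)) * x else 1)"
proof -
  let ?p = "enn2real (1 / (1 + l))"
  let ?B = "measure_pmf (bernoulli_pmf ?p)"
  let ?U = "uniform_measure lborel {0<..<1::real}"
  let ?f = "\<lambda>(B, U). of_bool B * U + (1 - of_bool B) :: real"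
  have "1 / (1 + l) \<le> 1"
    by (cases l) (auto simp: one_divide_one_plus_ennreal)
  then have p: "0 \<le> ?p" "?p \<le> 1"
    by (auto intro: enn2real_leI)
  interpret U: prob_space ?U by (rule prob_space_uniform_measure) auto
  have f [measurable]: "?f \<in> borel_measurable (?B \<Otimes>\<^sub>M ?U)"
    by measurable
  have "emeasure (U_law l) {..x} = emeasure (?B \<Otimes>\<^sub>M ?U) (?f -` {..x} \<inter> space (?B \<Otimes>\<^sub>M ?U))"
    unfolding U_law_def by (rule emeasure_distr[OF f]) auto
  also have "\<dots> = (\<integral>\<^sup>+t. emeasure ?U (Pair t -` (?f -` {..x} \<inter> space (?B \<Otimes>\<^sub>M ?U))) \<partial>?B)"
    by (rule U.emeasure_pair_measure_alt) measurable
  also have "\<dots> = emeasure ?U {..x} * ennreal ?p + emeasure ?U {u. 1 \<le> x} * ennreal (1 - ?p)"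
  proof -
    \<comment> \<open>The product measure is sliced along the Bernoulli value. In the slice
      \<open>False\<close> the variable is constantly 1, so the slice is everything or empty
      according to whether \<open>1 \<le> x\<close>.\<close>
    have "Pair True -` (?f -` {..x} \<inter> space (?B \<Otimes>\<^sub>M ?U)) = {..x}"
      "Pair False -` (?f -` {..x} \<inter> space (?B \<Otimes>\<^sub>M ?U)) = {u. 1 \<le> x}"
      by (auto simp: space_pair_measure)
    with p show ?thesis by (subst nn_integral_bernoulli_pmf) (simp_all only: zero_le)
  qed
  also have "\<dots> = ennreal (if x < 0 then 0 else if x < 1 then ?p * x else 1)"
  proof -
    have "emeasure ?U {..x} = emeasure lborel ({0<..<1} \<inter> {..x})"
      by (simp add: emeasure_uniform_measure divide_ennreal_def)
    also have "\<dots> = ennreal (if x < 0 then 0 else if x < 1 then x else 1)"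
    proof -
      have "{0<..<1} \<inter> {..x} = (if x < 0 then {} else if x < 1 then {0<..x} else {0<..<1})" by auto
      then show ?thesis by auto
    qed
    finally have "emeasure ?U {..x} = ennreal (if x < 0 then 0 else if x < 1 then x else 1)" .
    moreover have "emeasure ?U {u. 1 \<le> x} = (if 1 \<le> x then 1 else 0)"
      using U.emeasure_space_1 by simp
    ultimately show ?thesis using p
      by (auto simp: mult.commute simp flip: ennreal_mult' ennreal_plus)
  qed
  finally show ?thesis using p by (simp add: cdf_def measure_def)
qed

section \<open>Pointwise convergence of the distribution functions\<close>

theorem theorem3p2:
  fixes \<alpha> \<beta> :: "nat \<Rightarrow> real"
    and l :: ennreal
    and P :: "nat \<Rightarrow> 'a measure"
    and X :: "nat \<Rightarrow> nat \<Rightarrow> 'a \<Rightarrow> real"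
  assumes alpha_pos: "\<And>n. n \<ge> 1 \<Longrightarrow> \<alpha> n > 0"
    and beta_pos: "\<And>n. n \<ge> 1 \<Longrightarrow> \<beta> n > 0"
    and prob: "\<And>n. n \<ge> 1 \<Longrightarrow> prob_space (P n)"
    and dirichlet: "\<And>n. n \<ge> 1 \<Longrightarrow>
      distributed (P n) (Pi\<^sub>M {1..n} (\<lambda>_. lborel)) (\<lambda>\<omega>. \<lambda>i\<in>{1..n}. X n i \<omega>)
        (\<lambda>x. ennreal (dirichlet_density n (\<alpha> n) (\<beta> n) x))"
    and alpha_lim: "(\<lambda>n. real n * \<alpha> n) \<longlonglongrightarrow> 0"
    and ratio_lim: "(\<lambda>n. ennreal (real n * \<alpha> n / \<beta> n)) \<longlonglongrightarrow> l"
    and otherwise_case: "\<not> filterlim \<beta> at_top sequentially \<Longrightarrow>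
      (\<lambda>n. real n * \<alpha> n * ln (max 1 (\<beta> n))) \<longlonglongrightarrow> 0"
  shows "weak_conv_m
    (\<lambda>n. distr (P n) borel
       (\<lambda>\<omega>. (scale_seq \<beta> n * Max ((\<lambda>i. X n i \<omega>) ` {1..n})) powr (real n * \<alpha> n)))
    (U_law l)"
proof -
  define c where "c n = real n * \<alpha> n" for n
  define \<sigma> where "\<sigma> n = scale_seq \<beta> n" for n
  define p where "p = enn2real (1 / (1 + l))"
  define F where "F n = cdf (distr (P n) borel
    (\<lambda>\<omega>. (scale_seq \<beta> n * Max ((\<lambda>i. X n i \<omega>) ` {1..n})) powr (real n * \<alpha> n)))" for n
  have \<sigma>_pos: "0 < \<sigma> n" if "1 \<le> n" for n
    using beta_pos[OF that] by (auto simp: \<sigma>_def scale_seq_def)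
  have pos: "eventually (\<lambda>n. 0 < c n \<and> 0 < \<beta> n \<and> 0 < \<sigma> n) sequentially"
    using eventually_ge_at_top[of 1]
    by eventually_elim (auto simp: c_def alpha_pos beta_pos \<sigma>_pos)
  have c0: "c \<longlonglongrightarrow> 0" using alpha_lim unfolding c_def[abs_def] .
  have law_real: "real_distribution (distr (P n) borel
      (\<lambda>\<omega>. (scale_seq \<beta> n * Max ((\<lambda>i. X n i \<omega>) ` {1..n})) powr (real n * \<alpha> n)))" if "1 \<le> n" for n
    using prob_space_scaled_Max_law[OF that alpha_pos[OF that] beta_pos[OF that] \<sigma>_pos[OF that] dirichlet[OF that]]
    by (simp add: real_distribution_def real_distribution_axioms_def \<sigma>_def)
  have F_negative: "F n x = 0" if "1 \<le> n" "x < 0" for n x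
    using cdf_scaled_Max_law_negative[OF that(1) alpha_pos beta_pos \<sigma>_pos dirichlet] that
    by (simp add: F_def \<sigma>_def)
  have F_lower: "beta_cdf (c n) (\<beta> n) (1 * x powr (1 / c n) / \<sigma> n) \<le> F n x" if "1 \<le> n" "0 < x" for n x
    using cdf_scaled_Max_law_bounds(1)[OF that(1) alpha_pos beta_pos \<sigma>_pos dirichlet] that
    by (simp add: F_def \<sigma>_def c_def)
  have F_upper: "F n x \<le> beta_cdf (c n) (\<beta> n) (2 * x powr (1 / c n) / \<sigma> n) + 2 * c n" if "1 \<le> n" "0 < x" for n x
    using cdf_scaled_Max_law_bounds(2)[OF that(1) alpha_pos beta_pos \<sigma>_pos dirichlet] that
    by (simp add: F_def \<sigma>_def c_def)
  have F_nonneg: "0 \<le> F n x" for n x by (simp add: F_def cdf_def)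
  have F_le_1: "F n x \<le> 1" if "1 \<le> n" for n x
    unfolding F_def using real_distribution.cdf_bounded_prob[OF law_real[OF that]] .
  have F_mono: "F n x \<le> F n y" if "1 \<le> n" "x \<le> y" for n x y
  proof -
    interpret real_distribution "distr (P n) borel
      (\<lambda>\<omega>. (scale_seq \<beta> n * Max ((\<lambda>i. X n i \<omega>) ` {1..n})) powr (real n * \<alpha> n))"
      using that(1) by (rule law_real)
    show ?thesis unfolding F_def using that(2) by (rule cdf_nondecreasing)
  qed
  \<comment> \<open>The limit is taken in \<open>ennreal\<close>, where \<open>inverse\<close> is
    continuous everywhere and sends infinity to 0, so finite and infinite \<open>l\<close> are
    treated alike; the limit is finite and passes to the reals.\<close>
  have ratio: "(\<lambda>n. 1 / (1 + c n / \<beta> n)) \<longlonglongrightarrow> p"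
  proof -
    have "continuous_on UNIV (\<lambda>u::ennreal. inverse u)" by (intro continuous_intros)
    moreover have "(\<lambda>n. 1 + ennreal (c n / \<beta> n)) \<longlonglongrightarrow> 1 + l"
      using ratio_lim unfolding c_def by (intro tendsto_intros)
    ultimately have "(\<lambda>n. inverse (1 + ennreal (c n / \<beta> n))) \<longlonglongrightarrow> inverse (1 + l)"
      by (rule continuous_on_tendsto_compose) auto
    moreover have "1 / (1 + l) = ennreal p"
      unfolding p_def by (cases l) (simp_all add: one_divide_one_plus_ennreal)
    then have "inverse (1 + l) = ennreal p" by (simp add: divide_ennreal_def)
    ultimately have "(\<lambda>n. enn2real (inverse (1 + ennreal (c n / \<beta> n)))) \<longlonglongrightarrow> p"
      by (intro tendsto_enn2real) (simp_all add: p_def)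
    then show ?thesis
    proof (rule Lim_transform_eventually)
      show "eventually (\<lambda>n. enn2real (inverse (1 + ennreal (c n / \<beta> n))) = 1 / (1 + c n / \<beta> n)) sequentially"
        using pos
      proof eventually_elim
        case (elim n)
        then have "1 / (1 + ennreal (c n / \<beta> n)) = ennreal (1 / (1 + c n / \<beta> n))"
          by (intro one_divide_one_plus_ennreal) simp
        then show ?case using elim by (simp add: divide_ennreal_def)
      qed
    qed
  qed
  \<comment> \<open>If \<open>\<beta>\<close> tends to infinity, this is
    \<open>c n * ln (1 + 1 / \<beta> n)\<close>. Otherwise \<open>\<sigma> n = 1\<close>, and
    \<open>\<beta> n + 1 \<le> 2 * max 1 (\<beta> n)\<close> reduces the claim to
    \<open>otherwise_case\<close>. That hypothesis holds for bounded \<open>\<beta>\<close> and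
    excludes the alternating sequence described at \<open>scale_seq\<close>.\<close>
  have scale: "(\<lambda>n. c n * ln ((\<beta> n + 1) / \<sigma> n)) \<longlonglongrightarrow> 0"
  proof (cases "filterlim \<beta> at_top sequentially")
    case True
    have "(\<lambda>n. 1 / \<beta> n) \<longlonglongrightarrow> 0"
      using True by (intro tendsto_divide_0[OF tendsto_const] filterlim_at_top_imp_at_infinity)
    then have "(\<lambda>n. c n * ln (1 + 1 / \<beta> n)) \<longlonglongrightarrow> 0 * ln (1 + 0)"
      by (intro tendsto_intros c0) auto
    then have "(\<lambda>n. c n * ln (1 + 1 / \<beta> n)) \<longlonglongrightarrow> 0" by simp
    then show ?thesis
    proof (rule Lim_transform_eventually)
      show "eventually (\<lambda>n. c n * ln (1 + 1 / \<beta> n) = c n * ln ((\<beta> n + 1) / \<sigma> n)) sequentially"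
        using pos by eventually_elim (use True in \<open>simp add: \<sigma>_def scale_seq_def field_simps\<close>)
    qed
  next
    case False
    show ?thesis
    proof (rule Lim_null_comparison)
      show "eventually (\<lambda>n. norm (c n * ln ((\<beta> n + 1) / \<sigma> n)) \<le> c n * ln 2 + c n * ln (max 1 (\<beta> n))) sequentially"
        using pos
      proof eventually_elim
        case (elim n)
        have "ln (\<beta> n + 1) \<le> ln (2 * max 1 (\<beta> n))" using elim by (intro ln_mono) auto
        also have "\<dots> = ln 2 + ln (max 1 (\<beta> n))" by (rule ln_mult_pos) auto
        finally have "c n * ln (\<beta> n + 1) \<le> c n * (ln 2 + ln (max 1 (\<beta> n)))"
          using elim by (intro mult_left_mono) auto
        moreover have "0 \<le> c n * ln (\<beta> n + 1)" using elim by simp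
        ultimately show ?case using False by (simp add: \<sigma>_def scale_seq_def distrib_left)
      qed
      have "(\<lambda>n. c n * ln 2 + c n * ln (max 1 (\<beta> n))) \<longlonglongrightarrow> 0 * ln 2 + 0"
        using otherwise_case[OF False] unfolding c_def[symmetric] by (intro tendsto_intros c0)
      then show "(\<lambda>n. c n * ln 2 + c n * ln (max 1 (\<beta> n))) \<longlonglongrightarrow> 0" by simp
    qed
  qed
  \<comment> \<open>If \<open>\<beta>\<close> tends to infinity, \<open>c n / \<beta> n\<close>
    tends to 0, so the limit law has no atom at 1.\<close>
  have p_one: "p = 1" if "filterlim \<beta> at_top sequentially"
  proof -
    have "(\<lambda>n. c n / \<beta> n) \<longlonglongrightarrow> 0"
      using that by (intro tendsto_divide_0[OF c0] filterlim_at_top_imp_at_infinity)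
    then have "(\<lambda>n. 1 / (1 + c n / \<beta> n)) \<longlonglongrightarrow> 1 / (1 + 0)" by (intro tendsto_intros) auto
    then show ?thesis using LIMSEQ_unique[OF ratio] by simp
  qed
  \<comment> \<open>The lower bound has \<open>k = 1\<close> and the upper bound
    \<open>k = 2\<close>; both have the same limit.\<close>
  have interior: "(\<lambda>n. F n x) \<longlonglongrightarrow> p * x" if x: "0 < x" "x < 1" for x
  proof (rule tendsto_sandwich)
    show "eventually (\<lambda>n. beta_cdf (c n) (\<beta> n) (1 * x powr (1 / c n) / \<sigma> n) \<le> F n x) sequentially"
      using eventually_ge_at_top[of 1] by eventually_elim (rule F_lower[OF _ x(1)])
    show "eventually (\<lambda>n. F n x \<le> beta_cdf (c n) (\<beta> n) (2 * x powr (1 / c n) / \<sigma> n) + 2 * c n) sequentially"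
      using eventually_ge_at_top[of 1] by eventually_elim (rule F_upper[OF _ x(1)])
    show "(\<lambda>n. beta_cdf (c n) (\<beta> n) (1 * x powr (1 / c n) / \<sigma> n)) \<longlonglongrightarrow> p * x"
      by (rule beta_cdf_tendsto[OF pos c0 scale ratio _ x]) simp
    have "(\<lambda>n. beta_cdf (c n) (\<beta> n) (2 * x powr (1 / c n) / \<sigma> n) + 2 * c n) \<longlonglongrightarrow> p * x + 2 * 0"
      by (intro tendsto_intros c0 beta_cdf_tendsto[OF pos c0 scale ratio _ x]) simp
    then show "(\<lambda>n. beta_cdf (c n) (\<beta> n) (2 * x powr (1 / c n) / \<sigma> n) + 2 * c n) \<longlonglongrightarrow> p * x" by simp
  qed
  have p_nonneg: "0 \<le> p" by (simp add: p_def)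
  have at_0: "(\<lambda>n. F n 0) \<longlonglongrightarrow> 0"
  proof (rule order_tendstoI)
    fix e :: real assume "e < 0"
    then show "eventually (\<lambda>n. e < F n 0) sequentially" using F_nonneg less_le_trans by (intro always_eventually) blast
  next
    fix e :: real assume e: "0 < e"
    \<comment> \<open>Monotonicity compares 0 with a point \<open>y\<close> such that
      \<open>p * y \<le> e / 2\<close>; the denominator \<open>p + 1\<close> covers
      \<open>p = 0\<close>, and the cap 1/2 keeps \<open>y\<close> below 1.\<close>
    define y where "y = min (e / (2 * (p + 1))) (1 / 2)"
    have y: "0 < y" "y < 1" using e p_nonneg by (auto simp: y_def)
    have "p * y \<le> (p + 1) * (e / (2 * (p + 1)))"
      using y p_nonneg e by (intro mult_mono) (auto simp: y_def)
    also have "\<dots> < e" using e p_nonneg by (simp add: field_simps add_pos_nonneg)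
    finally have "eventually (\<lambda>n. F n y < e) sequentially" using order_tendstoD(2)[OF interior[OF y]] by blast
    then show "eventually (\<lambda>n. F n 0 < e) sequentially"
      using eventually_ge_at_top[of 1]
    proof eventually_elim
      case (elim n)
      with F_mono[of n 0 y] y show ?case by simp
    qed
  qed
  have above: "(\<lambda>n. F n x) \<longlonglongrightarrow> 1" if x: "1 \<le> x" for x
  proof (cases "filterlim \<beta> at_top sequentially")
    case True
    show ?thesis
    proof (rule order_tendstoI)
      fix e :: real assume e: "e < 1"
      \<comment> \<open>The midpoint of \<open>e\<close> and 1, raised to 1/2 if necessary to be
        positive. As \<open>p = 1\<close>, the limit at \<open>y\<close> exceeds \<open>e\<close>,
        and monotonicity carries this to \<open>x\<close>.\<close>
      define y where "y = max ((e + 1) / 2) (1 / 2)"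
      have y: "0 < y" "y < 1" "e < p * y" using e p_one[OF True] by (auto simp: y_def less_max_iff_disj)
      have "eventually (\<lambda>n. e < F n y) sequentially" using order_tendstoD(1)[OF interior[OF y(1,2)] y(3)] .
      then show "eventually (\<lambda>n. e < F n x) sequentially"
        using eventually_ge_at_top[of 1]
      proof eventually_elim
        case (elim n)
        with F_mono[of n y x] y x show ?case by simp
      qed
    next
      fix e :: real assume e: "1 < e"
      show "eventually (\<lambda>n. F n x < e) sequentially"
        using eventually_ge_at_top[of 1] by eventually_elim (rule le_less_trans[OF F_le_1 e])
    qed
  next
    case False
    have F_1: "F n x = 1" if "1 \<le> n" for n
      using cdf_scaled_Max_law_ge_1[OF that alpha_pos beta_pos \<sigma>_pos dirichlet _ x] that False
      by (simp add: F_def \<sigma>_def scale_seq_def)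
    have "eventually (\<lambda>n. F n x = 1) sequentially"
      using eventually_ge_at_top[of 1] by eventually_elim (rule F_1)
    then show ?thesis by (rule tendsto_eventually)
  qed
  \<comment> \<open>Convergence holds at every point, including a possible atom at 1; weak
    convergence asks for it at continuity points.\<close>
  have "(\<lambda>n. F n x) \<longlonglongrightarrow> cdf (U_law l) x" for x
  proof -
    consider "x < 0" | "x = 0" | "0 < x" "x < 1" | "1 \<le> x" by linarith
    then show ?thesis
    proof cases
      case 1
      have "eventually (\<lambda>n. F n x = 0) sequentially"
        using eventually_ge_at_top[of 1] by eventually_elim (rule F_negative[OF _ 1])
      with 1 show ?thesis by (simp add: cdf_U_law tendsto_eventually)
    qed (use at_0 interior above in \<open>auto simp: cdf_U_law p_def\<close>)
  qed
  then show ?thesis by (simp add: weak_conv_m_def weak_conv_def F_def)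
qed

end
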